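(* There exist two universal constants $c_1',c_2'>0$ such that the following holds. Let $n\ge3$ be an integer, $\alpha\in(0,1]$, $a,b\in(0,1)$, $\theta\in\Theta_{a,b}$, $\epsilon\in\left(0,\min\left(\frac b3,1\right)\right)$ and $\delta\in(0,1)$. Set $$T_1'=c_1'\,\frac{1}{\alpha^2a^4\epsilon^2}\ln\left(\frac{6n^2}{\delta}\right),\qquad T_2'=c_2'\,\frac{n}{\alpha^2a^2b^2}\ln\left(\frac{4n^2}{\delta}\right).$$ Let $\hat\theta(t)$ be the Triangular Estimation (TE) estimator computed from $X(1),\dots,X(t)$. Then for every integer $t\ge\max(T_1',T_2')$, $$\mathbb{P}\left(\|\hat\theta(t)-\theta\|_\infty\ge\epsilon\right)\le\delta.$$
   Context: Model. There are $n\ge 3$ workers, a parameter $\alpha\in(0,1]$ and a reliability vector $\theta=(\theta_1,\dots,\theta_n)\in[-1,1]^n$. The ground truths $G(1),G(2),\dots$ are i.i.d. uniform on $\{-1,+1\}$. For each task $t$, given $G(t)$, the outputs $X_1(t),\dots,X_n(t)$ are independent with $X_i(t)=G(t)$ with probability $\alpha\frac{1+\theta_i}{2}$, $X_i(t)=-G(t)$ with probability $\alpha\frac{1-\theta_i}{2}$, and $X_i(t)=0$ with probability $1-\alpha$. The pairs $(G(t),X(t))$ are i.i.d. over $t$. Only the $X(t)$ are observed. Notation. $\|\hat\theta-\theta\|_\infty=\max_{i}|\hat\theta_i-\theta_i|$; $A(\theta)=\min_{k}\max_{i,j\ne k,\ i\ne j}\sqrt{|\theta_i\theta_j|}$; $B(\theta)=\sum_{i=1}^n\theta_i$;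 for $a,b\in(0,1)$, $\Theta_{a,b}=\{\theta\in[-1,1]^n: A(\theta)\ge a,\ B(\theta)\ge b\}$. Convention: $\mathrm{sign}(x)=+$ if $x\ge0$ (in particular $\mathrm{sign}(0)=+$) and $-$ otherwise. TE estimator. From $X(1),\dots,X(t)$ compute, for $i\neq j$, $$\hat C_{ij}=\frac{\sum_{s=1}^tX_i(s)X_j(s)}{\max\left(\sum_{s=1}^t|X_i(s)X_j(s)|,1\right)}.$$ For each $k$, choose (ties broken arbitrarily) $(i_k,j_k)\in\arg\max|\hat C_{ij}|$ over pairs $(i,j)$ with $i,j,k$ distinct, and set $|\hat\theta_k|=\sqrt{\left|\hat C_{i_kk}\hat C_{j_kk}/\hat C_{i_kj_k}\right|}$ if $|\hat C_{i_kj_k}|>0$ and $|\hat\theta_k|=0$ otherwise. Then choose $k^*\in\arg\max_k\left|\hat\theta_k^2+\sum_{i\ne k}\hat C_{ik}\right|$ (where $\hat\theta_k^2=|\hat\theta_k|^2$), and set $\mathrm{sign}(\hat\theta_{k^*})=\mathrm{sign}\left(\hat\theta_{k^*}^2+\sum_{i\ne k^*}\hat C_{ik^*}\right)$ and $\mathrm{sign}(\hat\theta_k)=\mathrm{sign}(\hat\theta_{k^*}\hat C_{kk^*})$ for $k\neq k^*$. *)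

theory Defs
  imports "HOL-Probability.Probability"
begin

section \<open>Model\<close>

text \<open>
  Workers and tasks are numbered from 1, so a reliability vector is a function
  \<^typ>\<open>nat \<Rightarrow> real\<close> of which only the values on \<^term>\<open>{1..n}\<close> matter.
  The distribution below is meaningful only if the weights are nonnegative, i.e. for
  \<open>\<alpha> \<in> [0,1]\<close> and \<open>r \<in> [-1,1]\<close>; see \<open>pmf_answer_pmf\<close>.
\<close>

definition answer_pmf :: "real \<Rightarrow> real \<Rightarrow> int \<Rightarrow> int pmf" where
  "answer_pmf \<alpha> r g = pmf_of_list [(g, \<alpha> * (1 + r) / 2), (- g, \<alpha> * (1 - r) / 2), (0, 1 - \<alpha>)]"

definition task_pmf :: "nat \<Rightarrow> real \<Rightarrow> (nat \<Rightarrow> real) \<Rightarrow> (int \<times> (nat \<Rightarrow> int)) pmf" where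
  "task_pmf n \<alpha> \<theta> =
     bind_pmf (pmf_of_set {-1, 1}) (\<lambda>g.
     bind_pmf (Pi_pmf {1..n} 0 (\<lambda>i. answer_pmf \<alpha> (\<theta> i) g)) (\<lambda>x.
     return_pmf (g, x)))"

text \<open>
  A sample point \<open>\<omega>\<close> assigns to every task \<open>s\<close> the pair \<open>\<omega> s = (G(s), X(s))\<close>.
  Using the canonical product space rather than an arbitrary probability space keeps the
  type of sample points fixed, so that constants can be chosen uniformly in the model.
\<close>

definition crowd_space ::
  "nat \<Rightarrow> real \<Rightarrow> (nat \<Rightarrow> real) \<Rightarrow> (nat \<Rightarrow> int \<times> (nat \<Rightarrow> int)) measure" where
  "crowd_space n \<alpha> \<theta> = Pi\<^sub>M {1..} (\<lambda>_. measure_pmf (task_pmf n \<alpha> \<theta>))"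

text \<open>The observed data \<open>X(1), \<dots>, X(t)\<close>, without the ground truths and without later tasks.\<close>

definition observations ::
  "nat \<Rightarrow> nat \<Rightarrow> (nat \<Rightarrow> int \<times> (nat \<Rightarrow> int)) \<Rightarrow> nat \<Rightarrow> nat \<Rightarrow> int" where
  "observations n t \<omega> = (\<lambda>s\<in>{1..t}. \<lambda>i\<in>{1..n}. snd (\<omega> s) i)"


section \<open>The parameter class\<close>

definition pairs_avoiding :: "nat \<Rightarrow> nat \<Rightarrow> (nat \<times> nat) set" where
  "pairs_avoiding n k = {(i, j). i \<in> {1..n} \<and> j \<in> {1..n} \<and> i \<noteq> j \<and> i \<noteq> k \<and> j \<noteq> k}"

definition A_theta :: "nat \<Rightarrow> (nat \<Rightarrow> real) \<Rightarrow> real" where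
  "A_theta n \<theta> =
     Min ((\<lambda>k. Max ((\<lambda>(i, j). sqrt \<bar>\<theta> i * \<theta> j\<bar>) ` pairs_avoiding n k)) ` {1..n})"

definition B_theta :: "nat \<Rightarrow> (nat \<Rightarrow> real) \<Rightarrow> real" where
  "B_theta n \<theta> = (\<Sum>i=1..n. \<theta> i)"

definition Theta :: "nat \<Rightarrow> real \<Rightarrow> real \<Rightarrow> (nat \<Rightarrow> real) set" where
  "Theta n a b = {\<theta>. (\<forall>i\<in>{1..n}. \<theta> i \<in> {-1..1}) \<and> A_theta n \<theta> \<ge> a \<and> B_theta n \<theta> \<ge> b}"

definition linf_dist :: "nat \<Rightarrow> (nat \<Rightarrow> real) \<Rightarrow> (nat \<Rightarrow> real) \<Rightarrow> real" where
  "linf_dist n u v = Max ((\<lambda>i. \<bar>u i - v i\<bar>) ` {1..n})"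


section \<open>Triangular Estimation\<close>

text \<open>In contrast to \<^const>\<open>sgn\<close>, the sign of \<open>0\<close> is \<open>+\<close>.\<close>

definition sign_plus :: "real \<Rightarrow> real" where
  "sign_plus x = (if x \<ge> 0 then 1 else - 1)"

definition C_hat :: "nat \<Rightarrow> (nat \<Rightarrow> nat \<Rightarrow> int) \<Rightarrow> nat \<Rightarrow> nat \<Rightarrow> real" where
  "C_hat t x i j =
     of_int (\<Sum>s=1..t. x s i * x s j) / of_int (max (\<Sum>s=1..t. \<bar>x s i * x s j\<bar>) 1)"

definition TE_abs :: "nat \<Rightarrow> (nat \<Rightarrow> nat \<Rightarrow> int) \<Rightarrow> nat \<times> nat \<Rightarrow> nat \<Rightarrow> real" where
  "TE_abs t x = (\<lambda>(i, j) k.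
     if \<bar>C_hat t x i j\<bar> > 0 then sqrt \<bar>C_hat t x i k * C_hat t x j k / C_hat t x i j\<bar> else 0)"

definition TE_score :: "nat \<Rightarrow> nat \<Rightarrow> (nat \<Rightarrow> nat \<Rightarrow> int) \<Rightarrow> nat \<times> nat \<Rightarrow> nat \<Rightarrow> real" where
  "TE_score n t x p k = (TE_abs t x p k)\<^sup>2 + (\<Sum>i\<in>{1..n} - {k}. C_hat t x i k)"

text \<open>
  \<open>is_TE n t x e\<close>: the vector \<open>e\<close> is an output of the TE procedure on the data \<open>x\<close> for some
  way of breaking ties, both in the choice of the pairs \<open>p k = (i\<^sub>k, j\<^sub>k)\<close> and in that of
  \<open>m = k\<^sup>*\<close>.
\<close>

definition is_TE :: "nat \<Rightarrow> nat \<Rightarrow> (nat \<Rightarrow> nat \<Rightarrow> int) \<Rightarrow> (nat \<Rightarrow> real) \<Rightarrow> bool" where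
  "is_TE n t x e \<longleftrightarrow> (\<exists>p m.
     (\<forall>k\<in>{1..n}. is_arg_max (\<lambda>(i, j). \<bar>C_hat t x i j\<bar>) (\<lambda>q. q \<in> pairs_avoiding n k) (p k)) \<and>
     is_arg_max (\<lambda>k. \<bar>TE_score n t x (p k) k\<bar>) (\<lambda>k. k \<in> {1..n}) m \<and>
     e m = sign_plus (TE_score n t x (p m) m) * TE_abs t x (p m) m \<and>
     (\<forall>k\<in>{1..n} - {m}. e k = sign_plus (e m * C_hat t x k m) * TE_abs t x (p k) k))"


section \<open>Basic facts\<close>

lemma answer_pmf_wf:
  fixes \<alpha> r :: real and g :: int
  assumes "0 \<le> \<alpha>" "\<alpha> \<le> 1" "- 1 \<le> r" "r \<le> 1"
  shows "pmf_of_list_wf [(g, \<alpha> * (1 + r) / 2), (- g, \<alpha> * (1 - r) / 2), (0, 1 - \<alpha>)]"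
proof (rule pmf_of_list_wfI)
  have "0 \<le> \<alpha> * (1 + r) / 2" "0 \<le> \<alpha> * (1 - r) / 2"
    using assms by simp_all
  then show "0 \<le> w"
    if "w \<in> set (map snd [(g, \<alpha> * (1 + r) / 2), (- g, \<alpha> * (1 - r) / 2), (0, 1 - \<alpha>)])" for w
    using that assms(2) unfolding list.map snd_conv list.set by (elim insertE) simp_all
  show "sum_list (map snd [(g, \<alpha> * (1 + r) / 2), (- g, \<alpha> * (1 - r) / 2), (0, 1 - \<alpha>)]) = 1"
    by (simp add: field_simps)
qed

lemma pmf_answer_pmf:
  assumes "0 \<le> \<alpha>" "\<alpha> \<le> 1" "- 1 \<le> r" "r \<le> 1" and "g \<in> {-1, 1 :: int}"
  shows "pmf (answer_pmf \<alpha> r g) g = \<alpha> * (1 + r) / 2"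
    and "pmf (answer_pmf \<alpha> r g) (- g) = \<alpha> * (1 - r) / 2"
    and "pmf (answer_pmf \<alpha> r g) 0 = 1 - \<alpha>"
  using assms unfolding answer_pmf_def by (auto simp: pmf_pmf_of_list[OF answer_pmf_wf])

lemma prob_space_crowd_space: "prob_space (crowd_space n \<alpha> \<theta>)"
  unfolding crowd_space_def by (intro prob_space_PiM measure_pmf.prob_space_axioms)

text \<open>Every event defined through the observed data is measurable.\<close>

lemma observations_measurable:
  "{\<omega> \<in> space (crowd_space n \<alpha> \<theta>). P (observations n t \<omega>)} \<in> sets (crowd_space n \<alpha> \<theta>)"
proof -
  let ?M = "crowd_space n \<alpha> \<theta>"
  define D where "D = (\<Pi>\<^sub>E s\<in>{1..t}. \<Pi>\<^sub>E i\<in>{1..n}. (UNIV :: int set))"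
  have cD: "countable D"
    unfolding D_def by (intro countable_PiE) auto
  have obs: "observations n t \<omega> \<in> D" for \<omega>
    by (auto simp: D_def observations_def)
  have eq: "observations n t \<omega> = d \<longleftrightarrow> (\<forall>s\<in>{1..t}. \<forall>i\<in>{1..n}. snd (\<omega> s) i = d s i)"
    if "d \<in> D" for \<omega> d
  proof
    assume "\<forall>s\<in>{1..t}. \<forall>i\<in>{1..n}. snd (\<omega> s) i = d s i"
    moreover have "d s i = undefined" if "s \<in> {1..t}" "i \<notin> {1..n}" for s i
      using \<open>d \<in> D\<close> that unfolding D_def by (metis PiE_arb PiE_mem)
    moreover have "d s = undefined" if "s \<notin> {1..t}" for s
      using \<open>d \<in> D\<close> that unfolding D_def by (metis PiE_arb)
    ultimately show "observations n t \<omega> = d"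
      by (intro ext) (auto simp: observations_def restrict_def)
  qed (auto simp: observations_def)
  have "{\<omega> \<in> space ?M. observations n t \<omega> = d} \<in> sets ?M" if "d \<in> D" for d
  proof -
    have "(\<lambda>\<omega>. snd (\<omega> s) i) \<in> measurable ?M (count_space UNIV)" if "s \<in> {1..t}" for s i
      unfolding crowd_space_def
      by (rule measurable_compose[OF measurable_component_singleton]) (use that in auto)
    then have "{\<omega> \<in> space ?M. \<forall>s\<in>{1..t}. \<forall>i\<in>{1..n}. snd (\<omega> s) i = d s i} \<in> sets ?M"
      by (intro sets.sets_Collect_finite_All predE pred_eq_const1) auto
    then show ?thesis
      using eq[OF that] by simp
  qed
  then have "(\<Union>d\<in>{d\<in>D. P d}. {\<omega> \<in> space ?M. observations n t \<omega> = d}) \<in> sets ?M"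
    using cD by (intro sets.countable_UN') auto
  also have "(\<Union>d\<in>{d\<in>D. P d}. {\<omega> \<in> space ?M. observations n t \<omega> = d}) =
      {\<omega> \<in> space ?M. P (observations n t \<omega>)}"
    using obs by auto
  finally show ?thesis .
qed

lemma finite_pairs_avoiding: "finite (pairs_avoiding n k)"
  by (rule finite_subset[of _ "{1..n} \<times> {1..n}"]) (auto simp: pairs_avoiding_def)

lemma pairs_avoiding_nonempty:
  assumes "n \<ge> 3"
  shows "pairs_avoiding n k \<noteq> {}"
proof -
  have "(1, 2) \<in> pairs_avoiding n k \<or> (1, 3) \<in> pairs_avoiding n k \<or> (2, 3) \<in> pairs_avoiding n k"
    using assms by (auto simp: pairs_avoiding_def)
  then show ?thesis by blast
qed

lemma ex_is_arg_max:
  fixes f :: "'b \<Rightarrow> real"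
  assumes "finite S" "S \<noteq> {}"
  shows "\<exists>q. is_arg_max f (\<lambda>q. q \<in> S) q"
proof -
  have "Max (f ` S) \<in> f ` S"
    using assms by (intro Max_in) auto
  then obtain q where "q \<in> S" "f q = Max (f ` S)" by auto
  then have "is_arg_max f (\<lambda>q. q \<in> S) q"
    using assms(1) by (auto simp: is_arg_max_linorder)
  then show ?thesis ..
qed

lemma ex_is_TE:
  assumes "n \<ge> 3"
  shows "\<exists>e. is_TE n t x e"
proof -
  have "\<forall>k. \<exists>q. is_arg_max (\<lambda>(i, j). \<bar>C_hat t x i j\<bar>) (\<lambda>q. q \<in> pairs_avoiding n k) q"
    using ex_is_arg_max[OF finite_pairs_avoiding pairs_avoiding_nonempty[OF assms]] by blast
  then obtain p where
    p: "is_arg_max (\<lambda>(i, j). \<bar>C_hat t x i j\<bar>) (\<lambda>q. q \<in> pairs_avoiding n k) (p k)" for k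
    by metis
  obtain m where m: "is_arg_max (\<lambda>k. \<bar>TE_score n t x (p k) k\<bar>) (\<lambda>k. k \<in> {1..n}) m"
    using ex_is_arg_max[of "{1..n}" "\<lambda>k. \<bar>TE_score n t x (p k) k\<bar>"] assms by auto
  define c where "c = sign_plus (TE_score n t x (p m) m) * TE_abs t x (p m) m"
  define e where "e = (\<lambda>k. if k = m then c else sign_plus (c * C_hat t x k m) * TE_abs t x (p k) k)"
  have "is_TE n t x e"
    unfolding is_TE_def by (intro exI[of _ p] exI[of _ m]) (use p m in \<open>auto simp: e_def c_def\<close>)
  then show ?thesis by blast
qed

end

theory Submission
  imports Defs
begin

text \<open>
  Since only products of two answers enter, the correlations are linearised around the
  expected number \<open>v = \<alpha>\<^sup>2 t\<close> of common answers: with \<open>D\<^sub>i\<^sub>k\<close> the sum over \<open>s\<close> of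
  \<open>X\<^sub>i X\<^sub>k - \<theta>\<^sub>i \<theta>\<^sub>k \<bar>X\<^sub>i X\<^sub>k\<bar>\<close>, the estimate \<open>C_hat i k - \<theta>\<^sub>i \<theta>\<^sub>k\<close> is \<open>D\<^sub>i\<^sub>k / v\<close> up to an
  error quadratic in the relative deviations \<open>\<eta>\<close> of \<open>D\<^sub>i\<^sub>k\<close> and of the number of common answers.
  A union bound over pairs makes \<open>\<eta>\<^sup>2\<close> of order \<open>ln (n\<^sup>2 / \<delta>) / v\<close>, so a whole row of quadratic errors
  costs only \<open>n \<eta>\<^sup>2\<close>.  The row sums of the \<open>D\<^sub>i\<^sub>k\<close> are sums of i.i.d. terms; conditioning on
  \<open>X\<^sub>k\<close> makes the remaining answers independent, and Hoeffding's lemma gives a subgaussian moment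
  generating function with variance proxy of order \<open>\<alpha>\<^sup>2 ((B - \<theta>\<^sub>k)\<^sup>2 + n)\<close>, whence the linear
  dependence on \<open>n\<close>.

  Deterministically, each score is within \<open>B (\<bar>\<theta>\<^sub>k\<bar> + a) / 10\<close> of \<open>\<theta>\<^sub>k B\<close>, so the maximal score is attained
  at some \<open>m\<close> with \<open>\<bar>\<theta>\<^sub>m\<bar>\<close> at least half of every \<open>\<bar>\<theta>\<^sub>k\<bar>\<close>.  Hence the sign at \<open>m\<close> is correct, the estimate
  there does not vanish, and the sign of every \<open>\<theta>\<^sub>k\<close> that is not negligible against \<open>\<epsilon>\<close> is
  recovered.
\<close>


section \<open>Moment generating functions\<close>

text \<open>Hoeffding's lemma for a variable on \<open>{-1, 1}\<close> with mean \<open>r\<close>;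
  the range has length 2, whence \<open>(2 * u)\<^sup>2 / 8\<close>. The case of negative
  \<open>u\<close> follows by negating \<open>r\<close> and \<open>u\<close> together.\<close>

lemma two_point_mgf_le:
  fixes r u :: real
  assumes "\<bar>r\<bar> \<le> 1"
  shows "(1 + r) / 2 * exp u + (1 - r) / 2 * exp (- u) \<le> exp (u * r + u\<^sup>2 / 2)"
proof -
  have pos: "(1 + r) / 2 * exp u + (1 - r) / 2 * exp (- u) \<le> exp (u * r + u\<^sup>2 / 2)"
    if r: "\<bar>r\<bar> \<le> 1" and u: "u \<ge> 0" for r u :: real
  proof -
    define p where "p = (1 + r) / 2"
    have p: "0 \<le> p" "p \<le> 1" using r by (auto simp: p_def)
    have "1 + p * (exp (2 * u) - 1) \<ge> 1"
      using p u by simp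
    then have "1 + p * (exp (2 * u) - 1) = exp (ln (1 + p * (exp (2 * u) - 1)))"
      by simp
    also have "\<dots> \<le> exp (2 * u * p + (2 * u)\<^sup>2 / 8)"
      using Hoeffdings_lemma_aux[of "2 * u" p] u p by simp
    finally have "exp (- u) * (1 + p * (exp (2 * u) - 1)) \<le> exp (- u) * exp (2 * u * p + (2 * u)\<^sup>2 / 8)"
      by simp
    also have "\<dots> = exp (u * r + u\<^sup>2 / 2)"
      by (simp add: p_def field_simps flip: exp_add)
    also have "exp (- u) * (1 + p * (exp (2 * u) - 1)) = p * exp u + (1 - p) * exp (- u)"
    proof -
      have "exp (2 * u) = exp u * exp u" by (simp flip: exp_add)
      then show ?thesis by (simp add: exp_minus field_simps)
    qed
    finally show ?thesis by (simp add: p_def field_simps)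
  qed
  show ?thesis
  proof (cases "u \<ge> 0")
    case True
    then show ?thesis using pos assms by blast
  next
    case False
    then show ?thesis using pos[of "- r" "- u"] assms by (simp add: add.commute)
  qed
qed

text \<open>A silent worker contributes the factor 1. Linearising \<open>exp y\<close> before mixing
  and returning to an exponential afterwards moves the answering probability into the exponent;
  every power of \<alpha> in the tail bounds arises this way. For negative \<open>y\<close> the
  cubic Maclaurin remainder has the favourable sign.\<close>

lemma lazy_mgf_le:
  fixes \<alpha> y :: real
  assumes "0 \<le> \<alpha>" "y \<le> 1" "E \<le> exp y"
  shows "\<alpha> * E + (1 - \<alpha>) \<le> exp (\<alpha> * (y + y\<^sup>2))"
proof -
  have "exp y \<le> 1 + y + y\<^sup>2"
  proof (cases "0 \<le> y")
    case True
    then show ?thesis using assms exp_bound by blast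
  next
    case False
    obtain s where s: "\<bar>s\<bar> \<le> \<bar>y\<bar>" "exp y = (\<Sum>m<3. (y ^ m) / fact m) + (exp s / fact 3) * y ^ 3"
      using Maclaurin_exp_le[of y 3] by blast
    have "y ^ 3 \<le> 0" using False by simp
    then have "exp y \<le> 1 + y + y\<^sup>2 / 2"
      using s(2) by (simp add: eval_nat_numeral mult_nonneg_nonpos)
    then show ?thesis by (smt (verit) zero_le_power2 field_sum_of_halves)
  qed
  then have "\<alpha> * E \<le> \<alpha> * (1 + (y + y\<^sup>2))"
    using assms by (intro mult_left_mono) auto
  then have "\<alpha> * E + (1 - \<alpha>) \<le> 1 + \<alpha> * (y + y\<^sup>2)"
    by (simp add: algebra_simps)
  also have "\<dots> \<le> exp (\<alpha> * (y + y\<^sup>2))"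
    by (rule exp_ge_add_one_self)
  finally show ?thesis .
qed

text \<open>Handles one answer X_i given G = 1 and X_k = \<open>y\<close>, with \<open>r\<close> and
  \<open>s\<close> standing for \<theta>_i and \<theta>_k. The conditional mean
  \<open>l * r * (y - s)\<close> is kept exact, because it depends on \<open>y\<close> and has to be
  summed over all i before X_k is averaged out.\<close>

lemma leaf_mgf_le:
  fixes \<alpha> r s l y :: real
  assumes "0 \<le> \<alpha>" and r: "\<bar>r\<bar> \<le> 1" and s: "\<bar>s\<bar> \<le> 1" and l: "7 * l\<^sup>2 \<le> 1" and y: "y \<in> {1, - 1}"
  shows "\<alpha> * (1 + r) / 2 * exp (l * (y - r * s)) + \<alpha> * (1 - r) / 2 * exp (l * (- y - r * s)) + (1 - \<alpha>)
           \<le> exp (\<alpha> * (l * r * (y - s) + 7 * l\<^sup>2))"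
proof -
  define E where "E = (1 + r) / 2 * exp (l * (y - r * s)) + (1 - r) / 2 * exp (l * (- y - r * s))"
  define z where "z = l * r * (y - s) + l\<^sup>2 / 2"
  have y2: "y\<^sup>2 = 1" using y by auto
  have "E = exp (- l * r * s) * ((1 + r) / 2 * exp (l * y) + (1 - r) / 2 * exp (- (l * y)))"
    by (simp add: E_def field_simps exp_add exp_diff exp_minus)
  also have "\<dots> \<le> exp (- l * r * s) * exp ((l * y) * r + (l * y)\<^sup>2 / 2)"
    by (intro mult_left_mono two_point_mgf_le r) simp
  also have "\<dots> = exp z"
    using y2 by (simp add: z_def algebra_simps power_mult_distrib flip: exp_add)
  finally have E: "E \<le> exp z" .
  \<comment> \<open>This keeps \<open>z\<close> below 1, as \<open>lazy_mgf_le\<close> demands. The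
    constant 7 has to cover 1/2 from \<open>z\<close> and 121/25 from its square.\<close>
  have "\<bar>l\<bar> \<le> 2 / 5"
  proof (rule ccontr)
    assume "\<not> \<bar>l\<bar> \<le> 2 / 5"
    then have "\<bar>l\<bar>\<^sup>2 > (2 / 5)\<^sup>2" by (intro power_strict_mono) auto
    then show False using l by (simp add: power2_eq_square)
  qed
  have "\<bar>y - s\<bar> \<le> 2" using y s by auto
  then have "\<bar>r\<bar> * \<bar>y - s\<bar> \<le> 1 * 2" using r by (intro mult_mono) auto
  then have "\<bar>l\<bar> * (\<bar>r\<bar> * \<bar>y - s\<bar>) \<le> \<bar>l\<bar> * 2" by (intro mult_left_mono) auto
  then have 1: "\<bar>l * r * (y - s)\<bar> \<le> 2 * \<bar>l\<bar>" by (simp add: abs_mult mult.assoc)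
  have "l\<^sup>2 = \<bar>l\<bar> * \<bar>l\<bar>" by (simp add: power2_eq_square)
  also have "\<dots> \<le> \<bar>l\<bar> * (2 / 5)" using \<open>\<bar>l\<bar> \<le> 2 / 5\<close> by (intro mult_left_mono) auto
  finally have 2: "l\<^sup>2 \<le> \<bar>l\<bar> * (2 / 5)" .
  have z: "\<bar>z\<bar> \<le> 11 / 5 * \<bar>l\<bar>" 
    using 1 2 abs_triangle_ineq[of "l * r * (y - s)" "l\<^sup>2 / 2"] by (simp add: z_def)
  then have "z \<le> 1" using \<open>\<bar>l\<bar> \<le> 2 / 5\<close> by linarith
  have "z\<^sup>2 \<le> (11 / 5 * \<bar>l\<bar>)\<^sup>2" using z by (metis abs_ge_zero power2_abs power_mono)
  then have z2: "z\<^sup>2 \<le> 121 / 25 * l\<^sup>2" by (simp add: power_mult_distrib power2_eq_square)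
  have "\<alpha> * E + (1 - \<alpha>) \<le> exp (\<alpha> * (z + z\<^sup>2))"
    using lazy_mgf_le \<open>0 \<le> \<alpha>\<close> \<open>z \<le> 1\<close> E by blast
  also have "\<dots> \<le> exp (\<alpha> * (l * r * (y - s) + 7 * l\<^sup>2))"
  proof -
    have "z + z\<^sup>2 \<le> l * r * (y - s) + 7 * l\<^sup>2"
      using z2 z_def zero_le_power2[of l] by linarith
    then show ?thesis
      using \<open>0 \<le> \<alpha>\<close> by (simp add: mult_left_mono)
  qed
  finally show ?thesis by (simp add: E_def algebra_simps)
qed

text \<open>\<open>P y\<close> bounds the product over the leaves given that the centre answers
  \<open>y\<close>. Since \<open>y\<close> has mean \<open>s\<close> among actual answers, the
  linear term cancels on averaging and only the square of
  \<open>\<alpha> * l * (\<Sum>i\<in>S. r i)\<close> survives. The silence of the centre yields the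
  second factor \<alpha>.\<close>

lemma star_mgf_le:
  fixes \<alpha> s l K :: real and r :: "'i \<Rightarrow> real"
  assumes a: "0 \<le> \<alpha>" "\<alpha> \<le> 1" and s: "\<bar>s\<bar> \<le> 1"
    and K: "(\<Sum>i\<in>S. r i)\<^sup>2 + card S \<le> K" and l: "7 * K * l\<^sup>2 \<le> 1"
  defines "P y \<equiv> (\<Prod>i\<in>S. exp (\<alpha> * (l * r i * (y - s) + 7 * l\<^sup>2)))"
  shows "\<alpha> * (1 + s) / 2 * P 1 + \<alpha> * (1 - s) / 2 * P (- 1) + (1 - \<alpha>) \<le> exp (14 * \<alpha>\<^sup>2 * K * l\<^sup>2)"
proof (cases "finite S")
  case True
  define M where "M = (\<Sum>i\<in>S. r i)"
  define u where "u = \<alpha> * l * M"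
  define E where "E = (1 + s) / 2 * P 1 + (1 - s) / 2 * P (- 1)"
  have P: "P y = exp (7 * \<alpha> * card S * l\<^sup>2) * exp (u * (y - s))" for y
  proof -
    have "(\<Sum>i\<in>S. \<alpha> * (l * r i * (y - s) + 7 * l\<^sup>2)) = (\<Sum>i\<in>S. (\<alpha> * l * (y - s)) * r i + 7 * \<alpha> * l\<^sup>2)"
      by (intro sum.cong) (auto simp: algebra_simps)
    also have "\<dots> = 7 * \<alpha> * card S * l\<^sup>2 + u * (y - s)"
      by (simp add: sum.distrib u_def M_def flip: sum_distrib_left)
    finally show ?thesis
      using True by (simp add: P_def flip: exp_add exp_sum)
  qed
  have K0: "0 \<le> K" using K by (smt (verit) of_nat_0_le_iff zero_le_power2)
  have aa: "\<alpha>\<^sup>2 \<le> \<alpha>" using a by (simp add: power2_eq_square mult_left_le)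
  have "E = exp (7 * \<alpha> * card S * l\<^sup>2) * (exp (- u * s) * ((1 + s) / 2 * exp u + (1 - s) / 2 * exp (- u)))"
    unfolding E_def P by (simp add: field_simps exp_add exp_diff exp_minus)
  also have "\<dots> \<le> exp (7 * \<alpha> * card S * l\<^sup>2) * (exp (- u * s) * exp (u * s + u\<^sup>2 / 2))"
    by (intro mult_left_mono two_point_mgf_le s) simp_all
  also have "\<dots> = exp (7 * \<alpha> * card S * l\<^sup>2 + \<alpha>\<^sup>2 * l\<^sup>2 * M\<^sup>2 / 2)"
    by (simp add: u_def power_mult_distrib flip: exp_add)
  also have "\<dots> \<le> exp (7 * \<alpha> * K * l\<^sup>2)"
  proof -
    have "\<alpha>\<^sup>2 * (l\<^sup>2 * M\<^sup>2) \<le> \<alpha> * (l\<^sup>2 * M\<^sup>2)" using aa by (intro mult_right_mono) auto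
    moreover have "0 \<le> \<alpha> * (l\<^sup>2 * M\<^sup>2)" using a by simp
    moreover have "(7 * \<alpha> * l\<^sup>2) * (M\<^sup>2 + card S) \<le> (7 * \<alpha> * l\<^sup>2) * K"
      using K a by (intro mult_left_mono) (auto simp: M_def)
    ultimately show ?thesis by (simp add: algebra_simps)
  qed
  finally have E: "E \<le> exp (7 * \<alpha> * K * l\<^sup>2)" .
  have 0: "0 \<le> 7 * \<alpha> * K * l\<^sup>2" using a K0 by simp
  have "\<alpha> * (7 * K * l\<^sup>2) \<le> 1 * 1" using l a K0 by (intro mult_mono) auto
  then have 1: "7 * \<alpha> * K * l\<^sup>2 \<le> 1" by (simp add: algebra_simps)
  have "\<alpha> * E + (1 - \<alpha>) \<le> exp (\<alpha> * (7 * \<alpha> * K * l\<^sup>2 + (7 * \<alpha> * K * l\<^sup>2)\<^sup>2))"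
    using lazy_mgf_le a(1) 1 E by blast
  \<comment> \<open>A number in [0, 1] dominates its square, so the sum at most doubles the first
    term and 7 becomes 14.\<close>
  also have "\<dots> \<le> exp (\<alpha> * (7 * \<alpha> * K * l\<^sup>2 + 7 * \<alpha> * K * l\<^sup>2))"
    using a 0 1 mult_left_le[OF 1 0] unfolding exp_le_cancel_iff
    by (intro mult_left_mono add_left_mono) (simp_all only: power2_eq_square)
  finally show ?thesis by (simp add: E_def algebra_simps power2_eq_square)
next
  \<comment> \<open>For infinite \<open>S\<close> the sum and the cardinality default to 0 and the
    product to 1, so the left-hand side is 1.\<close>
  case False
  have "\<alpha> * (1 + s) / 2 + \<alpha> * (1 - s) / 2 = \<alpha>" by (simp add: field_simps)
  moreover have "0 \<le> K" using False K by simp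
  ultimately show ?thesis using False by (simp add: P_def)
qed

text \<open>Two workers both answer with probability \<open>\<alpha>\<^sup>2\<close>, so
  \<open>lazy_mgf_le\<close> applies with that probability; the factor
  \<open>exp (- l * \<alpha>\<^sup>2)\<close> centres the indicator.\<close>

lemma pair_count_mgf_le:
  fixes \<alpha> l :: real
  assumes "l \<le> 1"
  shows "(\<alpha>\<^sup>2 * exp l + (1 - \<alpha>\<^sup>2)) * exp (- l * \<alpha>\<^sup>2) \<le> exp (\<alpha>\<^sup>2 * l\<^sup>2)"
proof -
  have "(\<alpha>\<^sup>2 * exp l + (1 - \<alpha>\<^sup>2)) * exp (- l * \<alpha>\<^sup>2) \<le> exp (\<alpha>\<^sup>2 * (l + l\<^sup>2)) * exp (- l * \<alpha>\<^sup>2)"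
    using assms by (intro mult_right_mono lazy_mgf_le) auto
  also have "\<dots> = exp (\<alpha>\<^sup>2 * l\<^sup>2)"
    by (simp add: algebra_simps flip: exp_add)
  finally show ?thesis .
qed


section \<open>Concentration for i.i.d. tasks\<close>

text \<open>The product space has infinitely many tasks, but the sum sees only \<open>J\<close>:
  projecting to the finite product makes the exponential moment factorise, and Markov's inequality
  finishes.\<close>

lemma Chernoff_PiM_pmf:
  fixes q :: "'a pmf" and f :: "'a \<Rightarrow> real"
  assumes J: "finite J" "J \<subseteq> I" and l: "l > 0"
    and mgf: "(\<integral>\<^sup>+z. ennreal (exp (l * f z)) \<partial>q) \<le> ennreal (exp c)"
  defines "M \<equiv> Pi\<^sub>M I (\<lambda>_. measure_pmf q)"
  shows "measure M {\<omega> \<in> space M. (\<Sum>j\<in>J. f (\<omega> j)) \<ge> x} \<le> exp (c * card J - l * x)"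
proof -
  interpret PP: product_prob_space "\<lambda>_. measure_pmf q" I
    by standard
  have meas[measurable]: "(\<lambda>\<omega>. f (\<omega> j)) \<in> borel_measurable (Pi\<^sub>M I' (\<lambda>_. measure_pmf q))"
    if "j \<in> I'" for j I'
    by (rule measurable_compose[OF measurable_component_singleton]) (use that in auto)
  have JI: "j \<in> I" if "j \<in> J" for j using J that by auto
  have "(\<integral>\<^sup>+\<omega>. ennreal (exp (l * (\<Sum>j\<in>J. f (\<omega> j)))) \<partial>M)
      = (\<integral>\<^sup>+\<omega>. (\<Prod>j\<in>J. ennreal (exp (l * f (restrict \<omega> J j)))) \<partial>M)"
    using J by (intro nn_integral_cong) (simp add: sum_distrib_left exp_sum prod_ennreal)
  also have "\<dots> = (\<integral>\<^sup>+\<omega>. (\<Prod>j\<in>J. ennreal (exp (l * f (\<omega> j)))) \<partial>distr M (Pi\<^sub>M J (\<lambda>_. measure_pmf q)) (\<lambda>x. restrict x J))"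
    unfolding M_def using J
    by (intro nn_integral_distr[symmetric] measurable_restrict_subset) auto
  also have "\<dots> = (\<integral>\<^sup>+\<omega>. (\<Prod>j\<in>J. ennreal (exp (l * f (\<omega> j)))) \<partial>Pi\<^sub>M J (\<lambda>_. measure_pmf q))"
    unfolding M_def using PP.distr_PiM_restrict_finite[OF J] by simp
  also have "\<dots> = (\<Prod>j\<in>J. (\<integral>\<^sup>+z. ennreal (exp (l * f z)) \<partial>q))"
    using J by (intro PP.product_nn_integral_prod) auto
  also have "\<dots> \<le> (\<Prod>j\<in>J. ennreal (exp c))"
    by (intro prod_mono_ennreal mgf)
  also have "\<dots> = ennreal (exp (c * card J))"
    by (simp add: ennreal_power exp_of_nat2_mult)
  finally have mgf': "(\<integral>\<^sup>+\<omega>. ennreal (exp (l * (\<Sum>j\<in>J. f (\<omega> j)))) \<partial>M) \<le> ennreal (exp (c * card J))" .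
  have "emeasure M {\<omega> \<in> space M. (\<Sum>j\<in>J. f (\<omega> j)) \<ge> x}
      \<le> ennreal (exp (- l * x)) * (\<integral>\<^sup>+\<omega>. ennreal (exp (l * (\<Sum>j\<in>J. f (\<omega> j)))) * indicator (space M) \<omega> \<partial>M)"
    using JI l by (intro Chernoff_ineq_nn_integral_ge) (auto simp: M_def)
  also have "(\<integral>\<^sup>+\<omega>. ennreal (exp (l * (\<Sum>j\<in>J. f (\<omega> j)))) * indicator (space M) \<omega> \<partial>M) =
      (\<integral>\<^sup>+\<omega>. ennreal (exp (l * (\<Sum>j\<in>J. f (\<omega> j)))) \<partial>M)"
    by (intro nn_integral_cong) auto
  also have "ennreal (exp (- l * x)) * \<dots> \<le> ennreal (exp (- l * x)) * ennreal (exp (c * card J))"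
    by (intro mult_left_mono mgf') auto
  also have "\<dots> = ennreal (exp (c * card J - l * x))"
    by (simp flip: ennreal_mult exp_add)
  finally have "emeasure M {\<omega> \<in> space M. (\<Sum>j\<in>J. f (\<omega> j)) \<ge> x} \<le> ennreal (exp (c * card J - l * x))" .
  then show ?thesis
    unfolding M_def using PP.emeasure_eq_measure by simp
qed

text \<open>The one-sided bound is used for \<open>f\<close> and \<open>- f\<close>, so the moment
  bound is required only at the two parameters of modulus \<open>l\<close>. Measurability is
  recorded for the later union bound.\<close>

lemma subgaussian_PiM_pmf_tail:
  fixes q :: "'a pmf" and f :: "'a \<Rightarrow> real"
  assumes J: "finite J" "J \<subseteq> I" and l: "l > 0"
    and mgf: "\<And>l'. \<bar>l'\<bar> = l \<Longrightarrow> (\<integral>\<^sup>+z. ennreal (exp (l' * f z)) \<partial>q) \<le> ennreal (exp c)"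
  defines "M \<equiv> Pi\<^sub>M I (\<lambda>_. measure_pmf q)"
  shows "measure M {\<omega> \<in> space M. \<bar>\<Sum>j\<in>J. f (\<omega> j)\<bar> \<ge> x} \<le> 2 * exp (c * card J - l * x)"
    and "{\<omega> \<in> space M. \<bar>\<Sum>j\<in>J. f (\<omega> j)\<bar> \<ge> x} \<in> sets M"
proof -
  interpret PP: product_prob_space "\<lambda>_. measure_pmf q" I
    by standard
  have JI: "j \<in> I" if "j \<in> J" for j using J that by auto
  have meas[measurable]: "(\<lambda>\<omega>. f (\<omega> j)) \<in> borel_measurable M"
    if "j \<in> J" for j
    unfolding M_def by (rule measurable_compose[OF measurable_component_singleton]) (use that JI in auto)
  show "{\<omega> \<in> space M. \<bar>\<Sum>j\<in>J. f (\<omega> j)\<bar> \<ge> x} \<in> sets M"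
    by measurable
  let ?A = "{\<omega> \<in> space M. (\<Sum>j\<in>J. f (\<omega> j)) \<ge> x}" and ?B = "{\<omega> \<in> space M. (\<Sum>j\<in>J. - f (\<omega> j)) \<ge> x}"
  have sets: "?A \<in> sets M" "?B \<in> sets M" by measurable
  have "{\<omega> \<in> space M. \<bar>\<Sum>j\<in>J. f (\<omega> j)\<bar> \<ge> x} \<subseteq> ?A \<union> ?B"
    by (auto simp: sum_negf)
  then have "measure M {\<omega> \<in> space M. \<bar>\<Sum>j\<in>J. f (\<omega> j)\<bar> \<ge> x} \<le> measure M (?A \<union> ?B)"
    using sets unfolding M_def by (intro PP.finite_measure_mono) auto
  also have "\<dots> \<le> measure M ?A + measure M ?B"
    using sets by (rule measure_Un_le)
  also have "\<dots> \<le> exp (c * card J - l * x) + exp (c * card J - l * x)"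
    unfolding M_def using mgf[of l] mgf[of "- l"] l
    by (intro add_mono Chernoff_PiM_pmf J) auto
  finally show "measure M {\<omega> \<in> space M. \<bar>\<Sum>j\<in>J. f (\<omega> j)\<bar> \<ge> x} \<le> 2 * exp (c * card J - l * x)"
    by simp
qed

section \<open>Exponential moments of a single task\<close>

text \<open>Every factor involves coordinate \<open>k\<close> and one further coordinate. Splitting
  off \<open>k\<close> leaves a product over independent coordinates, padded with the factor 1
  outside \<open>S\<close> so that the product rule for the full index set applies.\<close>

lemma nn_integral_prod_Pi_pmf_star:
  fixes G :: "'i \<Rightarrow> 'a \<Rightarrow> 'a \<Rightarrow> ennreal"
  assumes I: "finite I" and k: "k \<in> I" and S: "S \<subseteq> I - {k}"
  shows "(\<integral>\<^sup>+x. (\<Prod>i\<in>S. G i (x k) (x i)) \<partial>Pi_pmf I d p) = (\<integral>\<^sup>+y. (\<Prod>i\<in>S. \<integral>\<^sup>+z. G i y z \<partial>p i) \<partial>p k)"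
proof -
  let ?A = "I - {k}"
  let ?G = "\<lambda>y i z. if i \<in> S then G i y z else 1"
  have ins: "I = insert k ?A" using k by auto
  have ext: "(\<Prod>i\<in>S. h i) = (\<Prod>i\<in>?A. if i \<in> S then h i else 1)" for h :: "'i \<Rightarrow> ennreal"
    using I S by (simp add: prod.If_cases Int_absorb1)
  have "(\<integral>\<^sup>+x. (\<Prod>i\<in>S. G i (x k) (x i)) \<partial>Pi_pmf I d p) =
      (\<integral>\<^sup>+y. \<integral>\<^sup>+x. (\<Prod>i\<in>S. G i y (if i = k then y else x i)) \<partial>Pi_pmf ?A d p \<partial>p k)"
    using I by (subst ins, subst Pi_pmf_insert)
      (auto simp: case_prod_unfold nn_integral_pair_pmf' cong: if_cong)
  also have "\<dots> = (\<integral>\<^sup>+y. \<integral>\<^sup>+x. (\<Prod>i\<in>?A. ?G y i (x i)) \<partial>Pi_pmf ?A d p \<partial>p k)"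
  proof (intro nn_integral_cong)
    fix y :: 'a and x :: "'i \<Rightarrow> 'a"
    have "(\<Prod>i\<in>S. G i y (if i = k then y else x i)) = (\<Prod>i\<in>S. G i y (x i))"
      using S by (intro prod.cong) auto
    then show "(\<Prod>i\<in>S. G i y (if i = k then y else x i)) = (\<Prod>i\<in>?A. ?G y i (x i))"
      by (simp add: ext)
  qed
  also have "\<dots> = (\<integral>\<^sup>+y. (\<Prod>i\<in>?A. \<integral>\<^sup>+z. ?G y i z \<partial>p i) \<partial>p k)"
    using I by (subst nn_integral_prod_Pi_pmf) auto
  also have "\<dots> = (\<integral>\<^sup>+y. (\<Prod>i\<in>S. \<integral>\<^sup>+z. G i y z \<partial>p i) \<partial>p k)"
    by (subst ext, intro nn_integral_cong prod.cong) auto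
  finally show ?thesis .
qed

lemma nn_integral_answer_pmf:
  fixes h :: "int \<Rightarrow> real"
  assumes "0 \<le> \<alpha>" "\<alpha> \<le> 1" "\<bar>r\<bar> \<le> 1" and h: "\<And>z. 0 \<le> h z"
  shows "(\<integral>\<^sup>+z. ennreal (h z) \<partial>answer_pmf \<alpha> r 1) =
    ennreal (\<alpha> * (1 + r) / 2 * h 1 + \<alpha> * (1 - r) / 2 * h (- 1) + (1 - \<alpha>) * h 0)"
proof -
  have r: "- 1 \<le> r" "r \<le> 1" "(1 :: int) \<in> {- 1, 1}"
    using assms(3) by auto
  have wf: "pmf_of_list_wf [(1 :: int, \<alpha> * (1 + r) / 2), (- 1, \<alpha> * (1 - r) / 2), (0, 1 - \<alpha>)]"
    using answer_pmf_wf[of \<alpha> r 1] assms by auto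
  have set: "set_pmf (answer_pmf \<alpha> r 1) \<subseteq> {1, - 1, 0}"
    unfolding answer_pmf_def using set_pmf_of_list[OF wf] by auto
  have "(\<integral>\<^sup>+z. ennreal (h z) \<partial>answer_pmf \<alpha> r 1)
      = (\<integral>\<^sup>+z. ennreal (h z) * indicator {1, - 1, 0} z \<partial>answer_pmf \<alpha> r 1)"
    using set by (intro nn_integral_cong_AE) (auto simp: AE_measure_pmf_iff indicator_def)
  also have "\<dots> = (\<Sum>z\<in>{1, - 1, 0}. ennreal (h z) * emeasure (measure_pmf (answer_pmf \<alpha> r 1)) {z})"
    by (rule nn_integral_indicator_finite) auto
  also have "\<dots> = (\<Sum>z\<in>{1, - 1, 0}. ennreal (h z * pmf (answer_pmf \<alpha> r 1) z))"
    by (intro sum.cong) (auto simp: emeasure_pmf_single ennreal_mult h)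
  also have "\<dots> = ennreal (\<Sum>z\<in>{1, - 1, 0}. h z * pmf (answer_pmf \<alpha> r 1) z)"
    by (intro sum_ennreal) (simp add: h)
  also have "(\<Sum>z\<in>{1, - 1, 0}. h z * pmf (answer_pmf \<alpha> r 1) z) =
      \<alpha> * (1 + r) / 2 * h 1 + \<alpha> * (1 - r) / 2 * h (- 1) + (1 - \<alpha>) * h 0"
    by (simp add: pmf_answer_pmf[of \<alpha> r 1, OF assms(1,2) r] mult.commute)
  finally show ?thesis .
qed

lemma answer_pmf_neg:
  assumes "0 \<le> \<alpha>" "\<alpha> \<le> 1" "\<bar>r\<bar> \<le> 1"
  shows "answer_pmf \<alpha> r (- 1) = answer_pmf \<alpha> (- r) 1"
proof (rule pmf_eqI)
  fix z
  have "pmf_of_list_wf [(- 1 :: int, \<alpha> * (1 + r) / 2), (1, \<alpha> * (1 - r) / 2), (0, 1 - \<alpha>)]"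
    "pmf_of_list_wf [(1 :: int, \<alpha> * (1 - r) / 2), (- 1, \<alpha> * (1 + r) / 2), (0, 1 - \<alpha>)]"
    using answer_pmf_wf[of \<alpha> r "- 1"] answer_pmf_wf[of \<alpha> "- r" 1] assms by auto
  then show "pmf (answer_pmf \<alpha> r (- 1)) z = pmf (answer_pmf \<alpha> (- r) 1) z"
    unfolding answer_pmf_def by (simp add: pmf_pmf_of_list)
qed

text \<open>Flipping the ground truth is the same as negating \<open>\<theta>\<close>, which is why it suffices to bound
  the expectation given \<open>G = 1\<close> for all parameters.\<close>

lemma nn_integral_task_pmf_le:
  fixes h :: "(nat \<Rightarrow> int) \<Rightarrow> ennreal"
  assumes \<alpha>: "0 \<le> \<alpha>" "\<alpha> \<le> 1" and \<theta>: "\<And>i. i \<in> {1..n} \<Longrightarrow> \<bar>\<theta> i\<bar> \<le> 1"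
    and pos: "(\<integral>\<^sup>+x. h x \<partial>Pi_pmf {1..n} 0 (\<lambda>i. answer_pmf \<alpha> (\<theta> i) 1)) \<le> C"
    and neg: "(\<integral>\<^sup>+x. h x \<partial>Pi_pmf {1..n} 0 (\<lambda>i. answer_pmf \<alpha> (- \<theta> i) 1)) \<le> C"
  shows "(\<integral>\<^sup>+z. h (snd z) \<partial>task_pmf n \<alpha> \<theta>) \<le> C"
proof -
  have "Pi_pmf {1..n} 0 (\<lambda>i. answer_pmf \<alpha> (\<theta> i) (- 1)) = Pi_pmf {1..n} 0 (\<lambda>i. answer_pmf \<alpha> (- \<theta> i) 1)"
    using answer_pmf_neg \<alpha> \<theta> by (intro Pi_pmf_cong) auto
  then have le: "(\<integral>\<^sup>+x. h x \<partial>Pi_pmf {1..n} 0 (\<lambda>i. answer_pmf \<alpha> (\<theta> i) g)) \<le> C" if "g \<in> {- 1, 1}" for g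
    using pos neg that by auto
  have "(\<integral>\<^sup>+z. h (snd z) \<partial>task_pmf n \<alpha> \<theta>) =
      (\<integral>\<^sup>+g. \<integral>\<^sup>+x. h x \<partial>Pi_pmf {1..n} 0 (\<lambda>i. answer_pmf \<alpha> (\<theta> i) g) \<partial>pmf_of_set {- 1, 1})"
    unfolding task_pmf_def by simp
  also have "\<dots> \<le> (\<integral>\<^sup>+g. C \<partial>pmf_of_set {- 1, 1 :: int})"
    using le by (intro nn_integral_mono_AE) (auto simp: AE_measure_pmf_iff)
  also have "\<dots> = C" by simp
  finally show ?thesis .
qed

lemma nn_integral_star_le:
  fixes \<theta> :: "nat \<Rightarrow> real"
  assumes \<alpha>: "0 \<le> \<alpha>" "\<alpha> \<le> 1" and \<theta>: "\<And>i. i \<in> {1..n} \<Longrightarrow> \<bar>\<theta> i\<bar> \<le> 1"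
    and k: "k \<in> {1..n}" and S: "S \<subseteq> {1..n} - {k}" "S \<noteq> {}"
    and K: "(\<Sum>i\<in>S. \<theta> i)\<^sup>2 + card S \<le> K" and l: "7 * K * l\<^sup>2 \<le> 1"
  shows "(\<integral>\<^sup>+x. ennreal (exp (l * (\<Sum>i\<in>S. of_int (x i * x k) - \<theta> i * \<theta> k * of_int \<bar>x i * x k\<bar>)))
      \<partial>Pi_pmf {1..n} 0 (\<lambda>i. answer_pmf \<alpha> (\<theta> i) 1)) \<le> ennreal (exp (14 * \<alpha>\<^sup>2 * K * l\<^sup>2))"
proof -
  let ?p = "\<lambda>i. answer_pmf \<alpha> (\<theta> i) 1"
  define g where "g i y z = exp (l * (of_int (z * y) - \<theta> i * \<theta> k * of_int \<bar>z * y\<bar>))" for i and y z :: int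
  define E where "E i y = \<alpha> * (1 + \<theta> i) / 2 * g i y 1 + \<alpha> * (1 - \<theta> i) / 2 * g i y (- 1) + (1 - \<alpha>)"
    for i and y :: int
  define P where "P y = (\<Prod>i\<in>S. exp (\<alpha> * (l * \<theta> i * (y - \<theta> k) + 7 * l\<^sup>2)))" for y :: real
  have fin: "finite S" using S(1) finite_subset by blast
  have g0: "g i y 0 = 1" "0 \<le> g i y z" for i y z by (auto simp: g_def)
  have \<theta>S: "\<bar>\<theta> i\<bar> \<le> 1" if "i \<in> S" for i using \<theta> S that by auto
  have \<theta>k: "\<bar>\<theta> k\<bar> \<le> 1" using \<theta> k by auto
  have E_nonneg: "0 \<le> E i y" if "i \<in> S" for i y
    unfolding E_def using \<alpha> \<theta>S[OF that] g0 by (auto intro!: add_nonneg_nonneg mult_nonneg_nonneg)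
  \<comment> \<open>A nonempty star forces \<open>K\<close> to be at least 1, so the condition on
    \<open>l\<close> for the whole star implies the one for each leaf.\<close>
  have "card S \<ge> 1" using fin S(2) by (simp add: Suc_leI card_gt_0_iff)
  then have "real (card S) \<ge> 1" by simp
  moreover have "(\<Sum>i\<in>S. \<theta> i)\<^sup>2 \<ge> 0" by simp
  ultimately have "K \<ge> 1" using K by linarith
  then have l7: "7 * l\<^sup>2 \<le> 1"
    using l mult_right_mono[of 1 K "7 * l\<^sup>2"] by simp
  have E_le: "E i y \<le> exp (\<alpha> * (l * \<theta> i * (of_int y - \<theta> k) + 7 * l\<^sup>2))" if "i \<in> S" "y \<in> {1, - 1}" for i y
  proof -
    have "\<bar>y\<bar> = 1"
      using that(2) by auto
    then have "g i y 1 = exp (l * (of_int y - \<theta> i * \<theta> k))" "g i y (- 1) = exp (l * (- of_int y - \<theta> i * \<theta> k))"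
      by (simp_all add: g_def del: of_int_mult)
    then show ?thesis
      using leaf_mgf_le[OF \<alpha>(1) \<theta>S[OF that(1)] \<theta>k l7, of "of_int y"] that(2)
      by (simp only: E_def) auto
  qed
  \<comment> \<open>A silent centre makes all products vanish, which accounts for the bare
    \<open>1 - \<alpha>\<close> in \<open>star_mgf_le\<close>.\<close>
  have E0: "E i 0 = 1" for i by (simp add: E_def g_def field_simps)
  have prod_le: "(\<Prod>i\<in>S. E i y) \<le> P (of_int y)" if "y \<in> {1, - 1}" for y
    unfolding P_def using E_le that E_nonneg by (intro prod_mono) auto
  have "(\<integral>\<^sup>+x. ennreal (exp (l * (\<Sum>i\<in>S. of_int (x i * x k) - \<theta> i * \<theta> k * of_int \<bar>x i * x k\<bar>)))
      \<partial>Pi_pmf {1..n} 0 ?p) = (\<integral>\<^sup>+x. (\<Prod>i\<in>S. ennreal (g i (x k) (x i))) \<partial>Pi_pmf {1..n} 0 ?p)"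
    unfolding g_def using fin by (intro nn_integral_cong) (simp only: sum_distrib_left exp_sum prod_ennreal exp_ge_zero)
  also have "\<dots> = (\<integral>\<^sup>+y. (\<Prod>i\<in>S. \<integral>\<^sup>+z. ennreal (g i y z) \<partial>?p i) \<partial>?p k)"
    using k S by (intro nn_integral_prod_Pi_pmf_star) auto
  also have "\<dots> = (\<integral>\<^sup>+y. ennreal (\<Prod>i\<in>S. E i y) \<partial>?p k)"
  proof (intro nn_integral_cong)
    fix y
    have "(\<Prod>i\<in>S. \<integral>\<^sup>+z. ennreal (g i y z) \<partial>?p i) = (\<Prod>i\<in>S. ennreal (E i y))"
      using \<alpha> \<theta>S g0 by (intro prod.cong refl) (simp add: nn_integral_answer_pmf E_def)
    also have "\<dots> = ennreal (\<Prod>i\<in>S. E i y)"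
      using E_nonneg by (rule prod_ennreal)
    finally show "(\<Prod>i\<in>S. \<integral>\<^sup>+z. ennreal (g i y z) \<partial>?p i) = ennreal (\<Prod>i\<in>S. E i y)" .
  qed
  also have "\<dots> \<le> (\<integral>\<^sup>+y. ennreal (if y = 0 then 1 else P (of_int y)) \<partial>?p k)"
  proof (intro nn_integral_mono_AE)
    have "set_pmf (?p k) \<subseteq> {1, - 1, 0}"
      unfolding answer_pmf_def using set_pmf_of_list[OF answer_pmf_wf[of \<alpha> "\<theta> k" 1]] \<alpha> \<theta>k by auto
    then show "AE y in ?p k. ennreal (\<Prod>i\<in>S. E i y) \<le> ennreal (if y = 0 then 1 else P (of_int y))"
      using prod_le by (auto simp: AE_measure_pmf_iff E0 intro!: ennreal_leI)
  qed
  also have "\<dots> = ennreal (\<alpha> * (1 + \<theta> k) / 2 * P 1 + \<alpha> * (1 - \<theta> k) / 2 * P (- 1) + (1 - \<alpha>))"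
    using \<alpha> \<theta>k by (subst nn_integral_answer_pmf) (auto simp: P_def prod_nonneg)
  also have "\<dots> \<le> ennreal (exp (14 * \<alpha>\<^sup>2 * K * l\<^sup>2))"
    unfolding P_def by (intro ennreal_leI star_mgf_le \<alpha> \<theta>k K l)
  finally show ?thesis .
qed

text \<open>The star computation with the single leaf \<open>i\<close>; the result does not depend
  on \<theta>, because absolute values erase correctness.\<close>

lemma nn_integral_pair_count_le:
  fixes \<theta> :: "nat \<Rightarrow> real"
  assumes \<alpha>: "0 \<le> \<alpha>" "\<alpha> \<le> 1" and \<theta>: "\<And>i. i \<in> {1..n} \<Longrightarrow> \<bar>\<theta> i\<bar> \<le> 1"
    and ik: "k \<in> {1..n}" "i \<in> {1..n}" "i \<noteq> k" and l: "l \<le> 1"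
  shows "(\<integral>\<^sup>+x. ennreal (exp (l * (of_int \<bar>x i * x k\<bar> - \<alpha>\<^sup>2)))
      \<partial>Pi_pmf {1..n} 0 (\<lambda>i. answer_pmf \<alpha> (\<theta> i) 1)) \<le> ennreal (exp (\<alpha>\<^sup>2 * l\<^sup>2))"
proof -
  let ?p = "\<lambda>i. answer_pmf \<alpha> (\<theta> i) 1"
  define g where "g y z = exp (l * (of_int \<bar>z * y\<bar> - \<alpha>\<^sup>2))" for y z :: int
  define E where "E y = \<alpha> * (1 + \<theta> i) / 2 * g y 1 + \<alpha> * (1 - \<theta> i) / 2 * g y (- 1) + (1 - \<alpha>) * g y 0" for y
  have b: "\<bar>\<theta> i\<bar> \<le> 1" "\<bar>\<theta> k\<bar> \<le> 1" using \<theta> ik by auto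
  have E: "E y = (\<alpha> * exp (l * \<bar>of_int y\<bar>) + (1 - \<alpha>)) * exp (- l * \<alpha>\<^sup>2)" for y
    by (simp add: E_def g_def field_simps abs_mult exp_diff exp_minus)
  have "(\<integral>\<^sup>+x. ennreal (exp (l * (of_int \<bar>x i * x k\<bar> - \<alpha>\<^sup>2))) \<partial>Pi_pmf {1..n} 0 ?p) =
      (\<integral>\<^sup>+x. (\<Prod>i\<in>{i}. ennreal (g (x k) (x i))) \<partial>Pi_pmf {1..n} 0 ?p)"
    by (simp add: g_def)
  also have "\<dots> = (\<integral>\<^sup>+y. (\<Prod>i\<in>{i}. \<integral>\<^sup>+z. ennreal (g y z) \<partial>?p i) \<partial>?p k)"
    using ik by (intro nn_integral_prod_Pi_pmf_star) auto
  also have "\<dots> = (\<integral>\<^sup>+y. ennreal (E y) \<partial>?p k)"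
    using \<alpha> b by (intro nn_integral_cong) (simp add: nn_integral_answer_pmf E_def g_def)
  also have "\<dots> = ennreal (\<alpha> * (1 + \<theta> k) / 2 * E 1 + \<alpha> * (1 - \<theta> k) / 2 * E (- 1) + (1 - \<alpha>) * E 0)"
    using \<alpha> b by (intro nn_integral_answer_pmf) (auto simp: E)
  also have "\<alpha> * (1 + \<theta> k) / 2 * E 1 + \<alpha> * (1 - \<theta> k) / 2 * E (- 1) + (1 - \<alpha>) * E 0 =
      (\<alpha>\<^sup>2 * exp l + (1 - \<alpha>\<^sup>2)) * exp (- l * \<alpha>\<^sup>2)"
    by (simp add: E field_simps power2_eq_square)
  also have "ennreal \<dots> \<le> ennreal (exp (\<alpha>\<^sup>2 * l\<^sup>2))"
    by (intro ennreal_leI pair_count_mgf_le l)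
  finally show ?thesis .
qed

section \<open>Tail bounds for sums over tasks\<close>

text \<open>Serves two purposes: \<open>S = {i}\<close> controls an individual correlation, and
  \<open>S\<close> consisting of all workers but \<open>k\<close> controls a row sum without a union
  bound over its entries.\<close>

lemma star_tail:
  fixes \<theta> :: "nat \<Rightarrow> real" and t :: nat
  assumes \<alpha>: "0 \<le> \<alpha>" "\<alpha> \<le> 1" and \<theta>: "\<And>i. i \<in> {1..n} \<Longrightarrow> \<bar>\<theta> i\<bar> \<le> 1"
    and k: "k \<in> {1..n}" and S: "S \<subseteq> {1..n} - {k}" "S \<noteq> {}"
    and K: "(\<Sum>i\<in>S. \<theta> i)\<^sup>2 + card S \<le> K" "0 < K" and y: "0 < y" "y\<^sup>2 \<le> 112 * K"
  defines "M \<equiv> crowd_space n \<alpha> \<theta>"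
    and "Bad \<equiv> {\<omega> \<in> space (crowd_space n \<alpha> \<theta>). y * (\<alpha>\<^sup>2 * real t) \<le>
      \<bar>\<Sum>s=1..t. \<Sum>i\<in>S. of_int (snd (\<omega> s) i * snd (\<omega> s) k) - \<theta> i * \<theta> k * of_int \<bar>snd (\<omega> s) i * snd (\<omega> s) k\<bar>\<bar>}"
  shows "measure M Bad \<le> 2 * exp (- (y\<^sup>2 * \<alpha>\<^sup>2 * t / (56 * K)))" and "Bad \<in> sets M"
proof -
  define f where "f z = (\<Sum>i\<in>S. of_int (snd z i * snd z k) - \<theta> i * \<theta> k * of_int \<bar>snd z i * snd z k\<bar>)"
    for z :: "int \<times> (nat \<Rightarrow> int)"
  \<comment> \<open>The minimiser of \<open>14 * K * l\<^sup>2 - l * y\<close>, with value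
    \<open>- y\<^sup>2 / (56 * K)\<close>. For this \<open>l\<close>, the bound
    \<open>y\<^sup>2 \<le> 112 * K\<close> is exactly the admissibility condition
    \<open>7 * K * l\<^sup>2 \<le> 1\<close>.\<close>
  define l where "l = y / (28 * K)"
  have l: "l > 0" using y K by (simp add: l_def)
  have mgf: "(\<integral>\<^sup>+z. ennreal (exp (l' * f z)) \<partial>task_pmf n \<alpha> \<theta>) \<le> ennreal (exp (14 * \<alpha>\<^sup>2 * K * l\<^sup>2))"
    if l': "\<bar>l'\<bar> = l" for l'
  proof -
    have sq: "l'\<^sup>2 = l\<^sup>2" using l' by (metis power2_abs)
    have "7 * K * l\<^sup>2 = y\<^sup>2 / (112 * K)"
      using K by (simp add: l_def field_simps power2_eq_square)
    also have "\<dots> \<le> 1" using y K by simp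
    finally have l7: "7 * K * l'\<^sup>2 \<le> 1" using sq by simp
    \<comment> \<open>Negating \<theta> changes neither the products \<theta>_i \<theta>_k nor the
      square of the sum over \<open>S\<close>, so the same \<open>K\<close> serves both ground
      truths.\<close>
    show ?thesis
      unfolding f_def sq[symmetric]
      using nn_integral_star_le[OF \<alpha> \<theta> k S K(1) l7] nn_integral_star_le[OF \<alpha> _ k S _ l7, of "\<lambda>i. - \<theta> i"] \<theta> K(1)
      by (intro nn_integral_task_pmf_le \<alpha> \<theta>) (auto simp: sum_negf)
  qed
  have J: "finite {1..t}" "{1..t} \<subseteq> {1..}" by auto
  note tail = subgaussian_PiM_pmf_tail[OF J l mgf, of "y * (\<alpha>\<^sup>2 * real t)", folded crowd_space_def]
  have "14 * \<alpha>\<^sup>2 * K * l\<^sup>2 * real (card {1..t}) - l * (y * (\<alpha>\<^sup>2 * real t)) = - (y\<^sup>2 * \<alpha>\<^sup>2 * t / (56 * K))"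
    using K by (simp add: l_def field_simps power2_eq_square)
  with tail show "measure M Bad \<le> 2 * exp (- (y\<^sup>2 * \<alpha>\<^sup>2 * t / (56 * K)))" "Bad \<in> sets M"
    unfolding M_def Bad_def f_def by simp_all
qed

lemma pair_count_tail:
  fixes \<theta> :: "nat \<Rightarrow> real" and t :: nat
  assumes \<alpha>: "0 \<le> \<alpha>" "\<alpha> \<le> 1" and \<theta>: "\<And>i. i \<in> {1..n} \<Longrightarrow> \<bar>\<theta> i\<bar> \<le> 1"
    and ik: "k \<in> {1..n}" "i \<in> {1..n}" "i \<noteq> k" and y: "0 < y" "y \<le> 2"
  defines "M \<equiv> crowd_space n \<alpha> \<theta>"
    and "Bad \<equiv> {\<omega> \<in> space (crowd_space n \<alpha> \<theta>). y * (\<alpha>\<^sup>2 * real t) \<le>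
      \<bar>\<Sum>s=1..t. of_int \<bar>snd (\<omega> s) i * snd (\<omega> s) k\<bar> - \<alpha>\<^sup>2\<bar>}"
  shows "measure M Bad \<le> 2 * exp (- (y\<^sup>2 * \<alpha>\<^sup>2 * t / 4))" and "Bad \<in> sets M"
proof -
  define f where "f z = of_int \<bar>snd z i * snd z k\<bar> - \<alpha>\<^sup>2" for z :: "int \<times> (nat \<Rightarrow> int)"
  \<comment> \<open>The minimiser of \<open>l\<^sup>2 - l * y\<close>; \<open>y \<le> 2\<close>
    keeps it at most 1.\<close>
  define l where "l = y / 2"
  have l: "l > 0" using y by (simp add: l_def)
  have mgf: "(\<integral>\<^sup>+z. ennreal (exp (l' * f z)) \<partial>task_pmf n \<alpha> \<theta>) \<le> ennreal (exp (\<alpha>\<^sup>2 * l\<^sup>2))"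
    if l': "\<bar>l'\<bar> = l" for l'
  proof -
    have sq: "l'\<^sup>2 = l\<^sup>2" using l' by (metis power2_abs)
    have "l' \<le> 1" using l' y by (simp add: l_def)
    then show ?thesis
      unfolding f_def sq[symmetric]
      using nn_integral_pair_count_le[OF \<alpha> \<theta> ik] nn_integral_pair_count_le[OF \<alpha> _ ik, of "\<lambda>i. - \<theta> i"] \<theta>
      by (intro nn_integral_task_pmf_le \<alpha> \<theta>) auto
  qed
  have J: "finite {1..t}" "{1..t} \<subseteq> {1..}" by auto
  note tail = subgaussian_PiM_pmf_tail[OF J l mgf, of "y * (\<alpha>\<^sup>2 * real t)", folded crowd_space_def]
  have "\<alpha>\<^sup>2 * l\<^sup>2 * real (card {1..t}) - l * (y * (\<alpha>\<^sup>2 * real t)) = - (y\<^sup>2 * \<alpha>\<^sup>2 * t / 4)"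
    by (simp add: l_def field_simps power2_eq_square)
  with tail show "measure M Bad \<le> 2 * exp (- (y\<^sup>2 * \<alpha>\<^sup>2 * t / 4))" "Bad \<in> sets M"
    unfolding M_def Bad_def f_def by simp_all
qed


section \<open>Error of Triangular Estimation under accurate correlations\<close>

text \<open>Here \<open>p\<close>, \<open>q\<close>, \<open>r\<close> are \<theta>_i, \<theta>_j,
  \<theta>_k, and the exact products satisfy \<open>(p * r) * (q * r) = r\<^sup>2 * (p * q)\<close>.
  The perturbation is expanded so that all first-order terms carry a factor
  \<open>\<bar>r\<bar>\<close>; this gives error of order \<kappa> for the absolute value instead of
  its square root.\<close>

lemma abs_quotient_sub_square_le:
  fixes u v w p q r \<kappa> a :: real
  assumes u: "\<bar>u - p * r\<bar> \<le> \<kappa>" and v: "\<bar>v - q * r\<bar> \<le> \<kappa>" and w: "\<bar>w - p * q\<bar> \<le> \<kappa>"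
    and b: "\<bar>p\<bar> \<le> 1" "\<bar>q\<bar> \<le> 1" "\<bar>r\<bar> \<le> 1" and a: "a > 0" "\<bar>w\<bar> \<ge> a\<^sup>2 / 2"
  shows "\<bar>\<bar>u * v / w\<bar> - r\<^sup>2\<bar> \<le> (6 * \<kappa> * \<bar>r\<bar> + 2 * \<kappa>\<^sup>2) / a\<^sup>2"
proof -
  have a2: "a\<^sup>2 > 0" using a by simp
  then have w0: "\<bar>w\<bar> > 0" using a by linarith
  have \<kappa>: "\<kappa> \<ge> 0" using u by linarith
  have 1: "\<bar>(u - p * r) * (v - q * r)\<bar> \<le> \<kappa> * \<kappa>"
    unfolding abs_mult using u v \<kappa> by (intro mult_mono) auto
  have 2: "\<bar>(u - p * r) * (q * r)\<bar> \<le> \<kappa> * (1 * \<bar>r\<bar>)"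
    unfolding abs_mult using u b \<kappa> by (intro mult_mono) auto
  have 3: "\<bar>(v - q * r) * (p * r)\<bar> \<le> \<kappa> * (1 * \<bar>r\<bar>)"
    unfolding abs_mult using v b \<kappa> by (intro mult_mono) auto
  have "\<bar>r\<bar> * \<bar>r\<bar> \<le> \<bar>r\<bar>" using b mult_left_le[of "\<bar>r\<bar>" "\<bar>r\<bar>"] by simp
  then have 4: "\<bar>(w - p * q) * (r * r)\<bar> \<le> \<kappa> * \<bar>r\<bar>"
    unfolding abs_mult using w \<kappa> by (intro mult_mono) auto
  have "u * v - r\<^sup>2 * w =
      (u - p * r) * (v - q * r) + (u - p * r) * (q * r) + (v - q * r) * (p * r) - (w - p * q) * (r * r)"
    by (simp add: algebra_simps power2_eq_square)
  then have "\<bar>u * v - r\<^sup>2 * w\<bar> \<le> \<kappa> * \<kappa> + 3 * (\<kappa> * \<bar>r\<bar>)"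
    using 1 2 3 4 by linarith
  moreover have "\<bar>\<bar>u * v\<bar> - r\<^sup>2 * \<bar>w\<bar>\<bar> \<le> \<bar>u * v - r\<^sup>2 * w\<bar>"
    using abs_triangle_ineq3[of "u * v" "r\<^sup>2 * w"] by (simp add: abs_mult)
  moreover have "\<bar>\<bar>u * v / w\<bar> - r\<^sup>2\<bar> = \<bar>\<bar>u * v\<bar> - r\<^sup>2 * \<bar>w\<bar>\<bar> / \<bar>w\<bar>"
  proof -
    have "\<bar>u * v / w\<bar> - r\<^sup>2 = (\<bar>u * v\<bar> - r\<^sup>2 * \<bar>w\<bar>) / \<bar>w\<bar>"
      using w0 by (simp add: abs_divide diff_divide_distrib)
    then show ?thesis by (simp only: abs_divide abs_idempotent)
  qed
  ultimately have "\<bar>\<bar>u * v / w\<bar> - r\<^sup>2\<bar> \<le> (\<kappa> * \<kappa> + 3 * (\<kappa> * \<bar>r\<bar>)) / \<bar>w\<bar>"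
    using w0 by (simp add: divide_right_mono)
  also have "\<dots> \<le> (\<kappa> * \<kappa> + 3 * (\<kappa> * \<bar>r\<bar>)) / (a\<^sup>2 / 2)"
    using a a2 w0 \<kappa> by (intro divide_left_mono) auto
  also have "\<dots> = (6 * \<kappa> * \<bar>r\<bar> + 2 * \<kappa>\<^sup>2) / a\<^sup>2"
    by (simp add: algebra_simps power2_eq_square)
  finally show ?thesis .
qed

lemma A_theta_geD:
  assumes "A_theta n \<theta> \<ge> a" and n: "n \<ge> 3" and k: "k \<in> {1..n}" and a: "a > 0"
  obtains i j where "(i, j) \<in> pairs_avoiding n k" "\<bar>\<theta> i * \<theta> j\<bar> \<ge> a\<^sup>2"
proof -
  let ?f = "\<lambda>(i, j). sqrt \<bar>\<theta> i * \<theta> j\<bar>"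
  have "a \<le> Max (?f ` pairs_avoiding n k)"
    using assms unfolding A_theta_def by (subst (asm) Min_ge_iff) auto
  then obtain ij where "ij \<in> pairs_avoiding n k" "a \<le> ?f ij"
    using finite_pairs_avoiding[of n k] pairs_avoiding_nonempty[OF n, of k] by (subst (asm) Max_ge_iff) auto
  then obtain i j where ij: "(i, j) \<in> pairs_avoiding n k" "a \<le> sqrt \<bar>\<theta> i * \<theta> j\<bar>"
    by (cases ij) auto
  then have "a\<^sup>2 \<le> (sqrt \<bar>\<theta> i * \<theta> j\<bar>)\<^sup>2" using a by (intro power_mono) auto
  then show ?thesis using ij that by simp
qed

text \<open>The deterministic core: entrywise accuracy gives the absolute values, and the separate
  row-sum accuracy fixes the global sign.\<close>

lemma TE_error_lt:
  assumes n: "n \<ge> 3" and a: "0 < a" "a < 1" and b: "0 < b" and \<theta>: "\<theta> \<in> Theta n a b"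
    and \<epsilon>: "0 < \<epsilon>" "\<epsilon> < b / 3" "\<epsilon> < 1" and TE: "is_TE n t x e"
    and C: "\<And>i j. i \<in> {1..n} \<Longrightarrow> j \<in> {1..n} \<Longrightarrow> i \<noteq> j \<Longrightarrow> \<bar>C_hat t x i j - \<theta> i * \<theta> j\<bar> \<le> \<kappa>"
    and \<kappa>: "\<kappa> \<le> a\<^sup>2 * \<epsilon> / 20"
    and row: "\<And>k. k \<in> {1..n} \<Longrightarrow>
      \<bar>\<Sum>i\<in>{1..n} - {k}. C_hat t x i k - \<theta> i * \<theta> k\<bar> \<le> a * B_theta n \<theta> / 25"
    and k: "k \<in> {1..n}"
  shows "\<bar>e k - \<theta> k\<bar> < \<epsilon>"
proof -
  define B where "B = B_theta n \<theta>"
  have B: "B \<ge> b" and \<theta>1: "\<And>i. i \<in> {1..n} \<Longrightarrow> \<bar>\<theta> i\<bar> \<le> 1" and A: "A_theta n \<theta> \<ge> a"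
    using \<theta> by (auto simp: Theta_def B_def abs_le_iff)
  have B0: "B > 0" using B b by simp
  have a2: "0 < a\<^sup>2" "a\<^sup>2 < 1" using a by (auto simp: power_less_one_iff)
  have \<kappa>0: "\<kappa> \<ge> 0" using C[of 1 2] n by force
  have "a\<^sup>2 * \<epsilon> \<le> a\<^sup>2 * 1" using \<epsilon> a2 by (intro mult_left_mono) auto
  then have \<kappa>a: "\<kappa> \<le> a\<^sup>2 / 20" using \<kappa> by simp
  obtain p m where p: "\<And>k. k \<in> {1..n} \<Longrightarrow>
        is_arg_max (\<lambda>(i, j). \<bar>C_hat t x i j\<bar>) (\<lambda>q. q \<in> pairs_avoiding n k) (p k)"
    and m: "is_arg_max (\<lambda>k. \<bar>TE_score n t x (p k) k\<bar>) (\<lambda>k. k \<in> {1..n}) m"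
    and em: "e m = sign_plus (TE_score n t x (p m) m) * TE_abs t x (p m) m"
    and ek: "\<And>k. k \<in> {1..n} - {m} \<Longrightarrow> e k = sign_plus (e m * C_hat t x k m) * TE_abs t x (p k) k"
    using TE unfolding is_TE_def by blast
  define h where "h k = TE_abs t x (p k) k" for k
  define sc where "sc k = TE_score n t x (p k) k" for k
  \<comment> \<open>The selected pair does at least as well as the pair that \<open>A_theta\<close>
    guarantees, so the denominator stays away from 0.\<close>
  have pk: "\<exists>i j. p k = (i, j) \<and> (i, j) \<in> pairs_avoiding n k \<and> \<bar>C_hat t x i j\<bar> \<ge> a\<^sup>2 - \<kappa>"
    if k: "k \<in> {1..n}" for k
  proof -
    obtain i' j' where ij': "(i', j') \<in> pairs_avoiding n k" "\<bar>\<theta> i' * \<theta> j'\<bar> \<ge> a\<^sup>2"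
      using A_theta_geD[OF A n k a(1)] .
    obtain i j where ij: "p k = (i, j)" by fastforce
    have "(i, j) \<in> pairs_avoiding n k" "\<bar>C_hat t x i' j'\<bar> \<le> \<bar>C_hat t x i j\<bar>"
      using p[OF k] ij' unfolding ij is_arg_max_linorder by auto
    moreover have "\<bar>C_hat t x i' j' - \<theta> i' * \<theta> j'\<bar> \<le> \<kappa>"
      using ij'(1) by (intro C) (auto simp: pairs_avoiding_def)
    ultimately show ?thesis using ij ij'(2) by auto
  qed
  have h0: "h k \<ge> 0" for k by (simp add: h_def TE_abs_def split: prod.split)
  have hsq: "\<bar>(h k)\<^sup>2 - (\<theta> k)\<^sup>2\<bar> \<le> 3 / 10 * \<epsilon> * \<bar>\<theta> k\<bar> + a\<^sup>2 * \<epsilon>\<^sup>2 / 200" if k: "k \<in> {1..n}" for k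
  proof -
    obtain i j where ij: "p k = (i, j)" "(i, j) \<in> pairs_avoiding n k" "\<bar>C_hat t x i j\<bar> \<ge> a\<^sup>2 - \<kappa>"
      using pk[OF k] by blast
    have Cij: "\<bar>C_hat t x i j\<bar> \<ge> a\<^sup>2 / 2" "\<bar>C_hat t x i j\<bar> > 0" using ij(3) \<kappa>a a2 by linarith+
    have rng: "i \<in> {1..n}" "j \<in> {1..n}" "i \<noteq> j" "i \<noteq> k" "j \<noteq> k" using ij(2) by (auto simp: pairs_avoiding_def)
    have "(h k)\<^sup>2 = \<bar>C_hat t x i k * C_hat t x j k / C_hat t x i j\<bar>"
      using Cij by (simp add: h_def TE_abs_def ij)
    then have "\<bar>(h k)\<^sup>2 - (\<theta> k)\<^sup>2\<bar> \<le> (6 * \<kappa> * \<bar>\<theta> k\<bar> + 2 * \<kappa>\<^sup>2) / a\<^sup>2"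
      using abs_quotient_sub_square_le[of "C_hat t x i k" "\<theta> i" "\<theta> k" \<kappa> "C_hat t x j k" "\<theta> j" "C_hat t x i j" a]
        C rng k \<theta>1 a Cij by auto
    also have "\<dots> \<le> (6 * (a\<^sup>2 * \<epsilon> / 20) * \<bar>\<theta> k\<bar> + 2 * (a\<^sup>2 * \<epsilon> / 20)\<^sup>2) / a\<^sup>2"
      using \<kappa> \<kappa>0 by (intro divide_right_mono add_mono mult_right_mono mult_left_mono power_mono) auto
    also have "\<dots> = 3 / 10 * \<epsilon> * \<bar>\<theta> k\<bar> + a\<^sup>2 * \<epsilon>\<^sup>2 / 200"
      using a by (simp add: field_simps power2_eq_square)
    finally show ?thesis .
  qed
  have herr: "\<bar>h k - \<bar>\<theta> k\<bar>\<bar> < \<epsilon>" if k: "k \<in> {1..n}" for k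
  proof (rule ccontr)
    assume "\<not> ?thesis"
    then have ge: "\<epsilon> \<le> \<bar>h k - \<bar>\<theta> k\<bar>\<bar>" by simp
    \<comment> \<open>Factor the difference of squares. An error of at least \<epsilon> makes
      \<open>s\<close> dominate both \<epsilon> and \<open>\<bar>\<theta> k\<bar>\<close>, so
      \<open>hsq\<close> bounds the difference by \<open>(3/10 + 1/200) * \<epsilon> * s\<close>,
      less than the required \<open>\<epsilon> * s\<close>.\<close>
    define s where "s = h k + \<bar>\<theta> k\<bar>"
    have s: "\<epsilon> \<le> s" "\<bar>\<theta> k\<bar> \<le> s" using ge h0[of k] unfolding s_def by linarith+
    have "(h k)\<^sup>2 - (\<theta> k)\<^sup>2 = (h k - \<bar>\<theta> k\<bar>) * s"
      by (simp add: s_def algebra_simps power2_eq_square)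
    then have "\<bar>(h k)\<^sup>2 - (\<theta> k)\<^sup>2\<bar> = \<bar>h k - \<bar>\<theta> k\<bar>\<bar> * s" using s \<epsilon> by (simp add: abs_mult)
    then have "\<epsilon> * s \<le> \<bar>(h k)\<^sup>2 - (\<theta> k)\<^sup>2\<bar>"
      using ge s \<epsilon> by (simp add: mult_right_mono)
    moreover have "\<epsilon> * \<bar>\<theta> k\<bar> \<le> \<epsilon> * s" using s \<epsilon> by (intro mult_left_mono) auto
    moreover have "a\<^sup>2 * \<epsilon>\<^sup>2 \<le> 1 * (\<epsilon> * s)"
      using s \<epsilon> a2 unfolding power2_eq_square[of \<epsilon>] by (intro mult_mono) auto
    moreover have "\<epsilon> * s > 0" using s \<epsilon> by simp
    ultimately show False using hsq[OF k] by simp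
  qed
  have score: "\<bar>sc k - \<theta> k * B\<bar> \<le> B / 10 * (\<bar>\<theta> k\<bar> + a)" if k: "k \<in> {1..n}" for k
  proof -
    have "\<theta> k * B = (\<theta> k)\<^sup>2 + (\<Sum>i\<in>{1..n} - {k}. \<theta> i * \<theta> k)"
      unfolding B_def B_theta_def using k
      by (subst sum.remove[of _ k]) (auto simp: algebra_simps power2_eq_square sum_distrib_left)
    then have "sc k - \<theta> k * B = ((h k)\<^sup>2 - (\<theta> k)\<^sup>2) + (\<Sum>i\<in>{1..n} - {k}. C_hat t x i k - \<theta> i * \<theta> k)"
      by (simp add: sc_def TE_score_def h_def sum_subtractf)
    then have "\<bar>sc k - \<theta> k * B\<bar> \<le> 3 / 10 * \<epsilon> * \<bar>\<theta> k\<bar> + a\<^sup>2 * \<epsilon>\<^sup>2 / 200 + a * B / 25"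
      using hsq[OF k] row[OF k] unfolding B_def by linarith
    \<comment> \<open>Here \<epsilon> < b/3 enters: it turns the error of the squared estimate into
      a tenth of \<open>B * \<bar>\<theta> k\<bar>\<close>.\<close>
    moreover have "3 * \<epsilon> * \<bar>\<theta> k\<bar> \<le> B * \<bar>\<theta> k\<bar>"
      using B \<epsilon> by (intro mult_right_mono) auto
    moreover have "a\<^sup>2 * \<epsilon>\<^sup>2 \<le> a * B"
    proof -
      have "a\<^sup>2 \<le> a" "\<epsilon>\<^sup>2 \<le> \<epsilon>" using a \<epsilon> by (simp_all add: power2_eq_square mult_left_le)
      then show ?thesis using B \<epsilon> a B0 by (intro mult_mono) auto
    qed
    moreover have "0 < a * B" using a B0 by simp
    ultimately show ?thesis by (simp add: algebra_simps)
  qed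
  have mn: "m \<in> {1..n}" and mmax: "\<And>k. k \<in> {1..n} \<Longrightarrow> \<bar>sc k\<bar> \<le> \<bar>sc m\<bar>"
    using m by (auto simp: is_arg_max_linorder sc_def)
  have cmp: "9 * \<bar>\<theta> k\<bar> \<le> 11 * \<bar>\<theta> m\<bar> + 2 * a" if k: "k \<in> {1..n}" for k
  proof -
    have "\<bar>\<theta> k * B\<bar> \<le> \<bar>\<theta> m * B\<bar> + B / 10 * (\<bar>\<theta> m\<bar> + a) + B / 10 * (\<bar>\<theta> k\<bar> + a)"
      using score[OF k] score[OF mn] mmax[OF k] by linarith
    then have "B * (9 * \<bar>\<theta> k\<bar>) \<le> B * (11 * \<bar>\<theta> m\<bar> + 2 * a)"
      using B0 by (simp add: abs_mult algebra_simps add_divide_distrib)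
    then show ?thesis using B0 by simp
  qed
  \<comment> \<open>Some worker of a good pair has reliability at least \<open>a\<close> in modulus;
    comparing its score with the maximal one gives 7/11 of \<open>a\<close>, more than 3/5.\<close>
  have \<theta>m: "\<bar>\<theta> m\<bar> \<ge> 3 / 5 * a"
  proof -
    obtain i j where ij: "(i, j) \<in> pairs_avoiding n k" "\<bar>\<theta> i * \<theta> j\<bar> \<ge> a\<^sup>2"
      using A_theta_geD[OF A n k a(1)] .
    have "\<bar>\<theta> i\<bar> \<ge> a \<or> \<bar>\<theta> j\<bar> \<ge> a"
    proof (rule ccontr)
      assume "\<not> ?thesis"
      then have "\<bar>\<theta> i\<bar> * \<bar>\<theta> j\<bar> < a * a" by (intro mult_strict_mono) auto
      then show False using ij(2) by (simp add: abs_mult power2_eq_square)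
    qed
    then show ?thesis
      using cmp[of i] cmp[of j] ij(1) a by (auto simp: pairs_avoiding_def)
  qed
  have \<theta>k2: "\<bar>\<theta> k\<bar> \<le> 2 * \<bar>\<theta> m\<bar>" if "k \<in> {1..n}" for k
    using cmp[OF that] \<theta>m by linarith
  have sgn_sc: "sign_plus (sc m) = sgn (\<theta> m)"
  proof -
    have "\<bar>\<theta> m\<bar> > 0" "a \<le> 2 * \<bar>\<theta> m\<bar>" using \<theta>m a by linarith+
    then have "B / 10 * (\<bar>\<theta> m\<bar> + a) \<le> B / 10 * (3 * \<bar>\<theta> m\<bar>)" using B0 by (intro mult_left_mono) auto
    also have "\<dots> < \<bar>\<theta> m * B\<bar>" using B0 \<open>\<bar>\<theta> m\<bar> > 0\<close> by (simp add: abs_mult)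
    finally have "\<bar>sc m - \<theta> m * B\<bar> < \<bar>\<theta> m * B\<bar>" using score[OF mn] by linarith
    then show ?thesis
      using B0 \<open>\<bar>\<theta> m\<bar> > 0\<close> mult_pos_pos[of "\<theta> m" B] mult_neg_pos[of "\<theta> m" B]
      by (cases "\<theta> m > 0") (auto simp: sign_plus_def)
  qed
  \<comment> \<open>If the estimate at \<open>m\<close> were 0, the rule would assign + to everybody
    else. Since \<open>m\<close> is within a factor 2 of each of \<open>i\<close> and
    \<open>j\<close>, its correlations with both are at least about half the large correlation of
    the pair, hence nonzero.\<close>
  have hm: "h m > 0"
  proof -
    obtain i j where ij: "p m = (i, j)" "(i, j) \<in> pairs_avoiding n m" "\<bar>C_hat t x i j\<bar> \<ge> a\<^sup>2 - \<kappa>"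
      using pk[OF mn] by blast
    have rng: "i \<in> {1..n}" "j \<in> {1..n}" "i \<noteq> j" "i \<noteq> m" "j \<noteq> m" using ij(2) by (auto simp: pairs_avoiding_def)
    have "\<bar>\<theta> i * \<theta> j\<bar> \<ge> a\<^sup>2 - 2 * \<kappa>" using C[of i j] rng ij(3) by fastforce
    moreover have "\<bar>\<theta> i * \<theta> j\<bar> \<le> 2 * \<bar>\<theta> i * \<theta> m\<bar>"
      using mult_left_mono[OF \<theta>k2[of j], of "\<bar>\<theta> i\<bar>"] rng by (simp add: abs_mult algebra_simps)
    moreover have "\<bar>\<theta> i * \<theta> j\<bar> \<le> 2 * \<bar>\<theta> j * \<theta> m\<bar>"
      using mult_right_mono[OF \<theta>k2[of i], of "\<bar>\<theta> j\<bar>"] rng by (simp add: abs_mult algebra_simps)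
    moreover have "\<bar>C_hat t x i m - \<theta> i * \<theta> m\<bar> \<le> \<kappa>" "\<bar>C_hat t x j m - \<theta> j * \<theta> m\<bar> \<le> \<kappa>"
      using C rng mn by auto
    ultimately have "\<bar>C_hat t x i m\<bar> > 0" "\<bar>C_hat t x j m\<bar> > 0" "\<bar>C_hat t x i j\<bar> > 0"
      using \<kappa>a a2 ij(3) by linarith+
    then show ?thesis by (simp add: h_def TE_abs_def ij)
  qed
  have sgn_err: "\<bar>sgn (\<theta> k) * h k - \<theta> k\<bar> < \<epsilon>" if "k \<in> {1..n}" "\<theta> k \<noteq> 0" for k
    using herr[OF that(1)] that(2) by (auto simp: sgn_real_def abs_real_def split: if_splits)
  have em': "e m = sgn (\<theta> m) * h m" using em sgn_sc by (simp add: sc_def h_def)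
  show ?thesis
  proof (cases "k = m")
    case True
    then show ?thesis using sgn_err[OF mn] em' \<theta>m a by auto
  next
    case False
    then have e: "e k = sign_plus (e m * C_hat t x k m) * h k" using ek k by (simp add: h_def)
    show ?thesis
    \<comment> \<open>Below the threshold the sign may be wrong, but the estimate and the truth are
      both so small that they differ by less than \<epsilon>. Above it, \<theta>_k \<theta>_m
      exceeds \<open>3/50 * a\<^sup>2 * \<epsilon>\<close> in modulus, which beats the bound
      \<open>a\<^sup>2 * \<epsilon> / 20\<close> on \<kappa>, so the sign of the correlation is
      right.\<close>
    proof (cases "\<bar>\<theta> k\<bar> \<le> a * \<epsilon> / 10")
      case True
      have "(h k)\<^sup>2 < (\<epsilon> / 4)\<^sup>2"
      proof -
        have "a * \<epsilon> \<le> 1 * \<epsilon>" using a \<epsilon> by (intro mult_right_mono) auto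
        then have t: "\<bar>\<theta> k\<bar> \<le> \<epsilon> / 10" using True by simp
        then have "\<bar>\<theta> k\<bar>\<^sup>2 \<le> (\<epsilon> / 10)\<^sup>2" by (intro power_mono) auto
        moreover have "\<epsilon> * \<bar>\<theta> k\<bar> \<le> \<epsilon> * (\<epsilon> / 10)" using t \<epsilon> by (intro mult_left_mono) auto
        moreover have "a\<^sup>2 * \<epsilon>\<^sup>2 \<le> 1 * \<epsilon>\<^sup>2" using a2 by (intro mult_right_mono) auto
        moreover have "0 < \<epsilon>\<^sup>2" using \<epsilon> by simp
        ultimately show ?thesis using hsq[OF k] by (simp add: power2_eq_square)
      qed
      then have "h k < \<epsilon> / 4" by (rule power2_less_imp_less) (use \<epsilon> in simp)
      moreover have "\<bar>e k\<bar> = h k" using e h0[of k] by (simp add: sign_plus_def)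
      moreover have "a * \<epsilon> < 1 * \<epsilon>" using a \<epsilon> by (intro mult_strict_right_mono) auto
      ultimately show ?thesis using True \<epsilon> by linarith
    next
      case False
      have \<theta>k0: "\<theta> k \<noteq> 0" using False a \<epsilon> by auto
      have "(a * \<epsilon> / 10) * (3 / 5 * a) = 3 / 50 * (a\<^sup>2 * \<epsilon>)"
        by (simp add: power2_eq_square)
      then have "\<kappa> < (a * \<epsilon> / 10) * (3 / 5 * a)"
        using \<kappa> mult_pos_pos[OF a2(1) \<epsilon>(1)] by linarith
      also have "\<dots> \<le> \<bar>\<theta> k\<bar> * \<bar>\<theta> m\<bar>" using False \<theta>m a \<epsilon> by (intro mult_mono) auto
      finally have "\<bar>C_hat t x k m - \<theta> k * \<theta> m\<bar> < \<bar>\<theta> k * \<theta> m\<bar>"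
        using C[OF k mn \<open>k \<noteq> m\<close>] by (simp add: abs_mult)
      then have sC: "sgn (C_hat t x k m) = sgn (\<theta> k) * sgn (\<theta> m)"
        unfolding sgn_mult[symmetric] by (auto simp: sgn_real_def)
      have \<theta>m0: "\<theta> m \<noteq> 0" using \<theta>m a by auto
      have "sgn (\<theta> m) * sgn (\<theta> m) = 1" using \<theta>m0 by (simp add: sgn_real_def)
      moreover have "sgn (e m * C_hat t x k m) = sgn (\<theta> k) * (sgn (\<theta> m) * sgn (\<theta> m))"
        using hm by (simp add: em' sgn_mult sC mult_ac)
      ultimately have "sgn (e m * C_hat t x k m) = sgn (\<theta> k)" by simp
      then have "sign_plus (e m * C_hat t x k m) = sgn (\<theta> k)"
        using \<theta>k0 by (auto simp: sign_plus_def sgn_real_def split: if_splits)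
      then show ?thesis using e sgn_err[OF k \<theta>k0] by simp
    qed
  qed
qed

section \<open>Linearisation of an empirical ratio\<close>

text \<open>The exact error is \<open>(S - c * N) / N\<close>. Replacing the denominator by
  \<open>v\<close> costs this error times \<open>(v - N) / v\<close>, a product of two relative
  deviations. Since \<open>N\<close> is at least \<open>v / 2\<close>, it is a positive integer and
  the truncation at 1 is inactive.\<close>

lemma ratio_linearization:
  fixes S N :: int and c v \<eta> :: real
  assumes v: "v > 0" and \<eta>: "\<eta> \<le> 1 / 2" and D: "\<bar>S - c * N\<bar> \<le> \<eta> * v" and N: "\<bar>N - v\<bar> \<le> \<eta> * v"
  shows "\<bar>S / of_int (max N 1) - c\<bar> \<le> 2 * \<eta>"
    and "\<bar>S / of_int (max N 1) - c - (S - c * N) / v\<bar> \<le> 2 * \<eta>\<^sup>2"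
proof -
  have "\<eta> * v \<le> 1 / 2 * v" using v \<eta> by (intro mult_right_mono) auto
  then have N2: "v / 2 \<le> N" using N by linarith
  have "0 \<le> \<eta> * v" using N by linarith
  then have \<eta>0: "0 \<le> \<eta>" using v by (simp add: zero_le_mult_iff)
  have N0: "real_of_int N > 0" using N2 v by linarith
  then have max: "max N 1 = N" by simp
  have eq: "S / N - c = (S - c * N) / N" using N0 by (simp add: field_simps)
  have "\<bar>S / N - c\<bar> = \<bar>S - c * N\<bar> / N" unfolding eq using N0 by simp
  also have "\<dots> \<le> (\<eta> * v) / (v / 2)" using D N2 v N0 \<eta>0 by (intro frac_le) auto
  also have "\<dots> = 2 * \<eta>" using v by simp
  finally show 1: "\<bar>S / of_int (max N 1) - c\<bar> \<le> 2 * \<eta>" unfolding max .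
  have "S / N - c - (S - c * N) / v = (S / N - c) * ((v - N) / v)"
    unfolding eq using v N0 by (simp add: field_simps)
  then have "\<bar>S / N - c - (S - c * N) / v\<bar> = \<bar>S / N - c\<bar> * (\<bar>N - v\<bar> / v)"
    using v by (simp add: abs_mult abs_minus_commute)
  also have "\<dots> \<le> (2 * \<eta>) * ((\<eta> * v) / v)"
    using 1 N v \<eta>0 unfolding max by (intro mult_mono divide_right_mono) auto
  also have "\<dots> = 2 * \<eta>\<^sup>2" using v by (simp add: power2_eq_square)
  finally show "\<bar>S / of_int (max N 1) - c - (S - c * N) / v\<bar> \<le> 2 * \<eta>\<^sup>2" unfolding max .
qed


section \<open>Failure probability\<close>

text \<open>Centring by the random count of common answers rather than by its mean makes this
  exactly the numerator of the correlation error.\<close>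

definition pair_dev :: "(nat \<Rightarrow> real) \<Rightarrow> nat \<Rightarrow> (nat \<Rightarrow> int \<times> (nat \<Rightarrow> int)) \<Rightarrow> nat \<Rightarrow> nat \<Rightarrow> real" where
  "pair_dev \<theta> t \<omega> i k = (\<Sum>s=1..t. of_int (snd (\<omega> s) i * snd (\<omega> s) k) -
     \<theta> i * \<theta> k * of_int \<bar>snd (\<omega> s) i * snd (\<omega> s) k\<bar>)"

lemma C_hat_observations_dev:
  assumes v: "v = \<alpha>\<^sup>2 * real t" "v > 0" and \<eta>: "\<eta> \<le> 1 / 2" and ik: "i \<in> {1..n}" "k \<in> {1..n}"
    and D: "\<bar>pair_dev \<theta> t \<omega> i k\<bar> \<le> \<eta> * v"
    and N: "\<bar>\<Sum>s=1..t. of_int \<bar>snd (\<omega> s) i * snd (\<omega> s) k\<bar> - \<alpha>\<^sup>2\<bar> \<le> \<eta> * v"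
  shows "\<bar>C_hat t (observations n t \<omega>) i k - \<theta> i * \<theta> k\<bar> \<le> 2 * \<eta>"
    and "\<bar>C_hat t (observations n t \<omega>) i k - \<theta> i * \<theta> k - pair_dev \<theta> t \<omega> i k / v\<bar> \<le> 2 * \<eta>\<^sup>2"
proof -
  define S where "S = (\<Sum>s=1..t. snd (\<omega> s) i * snd (\<omega> s) k)"
  define N' where "N' = (\<Sum>s=1..t. \<bar>snd (\<omega> s) i * snd (\<omega> s) k\<bar>)"
  have C: "C_hat t (observations n t \<omega>) i k = S / of_int (max N' 1)"
    using ik by (simp add: C_hat_def observations_def S_def N'_def)
  have pd: "pair_dev \<theta> t \<omega> i k = S - \<theta> i * \<theta> k * N'"
    by (simp add: pair_dev_def S_def N'_def sum_subtractf sum_distrib_left)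
  have N'': "(\<Sum>s=1..t. of_int \<bar>snd (\<omega> s) i * snd (\<omega> s) k\<bar> - \<alpha>\<^sup>2) = N' - v"
    by (simp add: N'_def v sum_subtractf)
  show "\<bar>C_hat t (observations n t \<omega>) i k - \<theta> i * \<theta> k\<bar> \<le> 2 * \<eta>"
    "\<bar>C_hat t (observations n t \<omega>) i k - \<theta> i * \<theta> k - pair_dev \<theta> t \<omega> i k / v\<bar> \<le> 2 * \<eta>\<^sup>2"
    using ratio_linearization[OF v(2) \<eta> D[unfolded pd] N[unfolded N'']] unfolding C pd by auto
qed

lemma TE_failure_le:
  fixes \<theta> :: "nat \<Rightarrow> real"
  assumes n: "n \<ge> 3" and \<alpha>: "0 < \<alpha>" "\<alpha> \<le> 1" and a: "0 < a" "a < 1" and b: "0 < b" "b < 1"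
    and \<theta>: "\<theta> \<in> Theta n a b" and \<epsilon>: "0 < \<epsilon>" "\<epsilon> < b / 3" "\<epsilon> < 1"
    and TE: "\<And>x. is_TE n t x (TE x)" and L: "0 < L"
    and t1: "real t \<ge> 400000 * L / (\<alpha>\<^sup>2 * a ^ 4 * \<epsilon>\<^sup>2)"
    and t2: "real t \<ge> 2000000 * n * L / (\<alpha>\<^sup>2 * a\<^sup>2 * b\<^sup>2)"
  shows "measure (crowd_space n \<alpha> \<theta>)
         {\<omega> \<in> space (crowd_space n \<alpha> \<theta>). linf_dist n (TE (observations n t \<omega>)) \<theta> \<ge> \<epsilon>}
       \<le> 6 * (real n)\<^sup>2 * exp (- (2 * L))"
proof -
  define B where "B = B_theta n \<theta>"
  define v where "v = \<alpha>\<^sup>2 * real t"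
  \<comment> \<open>Chosen so that the single-pair exponent \<open>\<eta>\<^sup>2 * v / 112\<close>
    equals \<open>2 * L\<close>.\<close>
  define \<eta> where "\<eta> = sqrt (224 * L / v)"
  define M where "M = crowd_space n \<alpha> \<theta>"
  interpret prob_space M unfolding M_def by (rule prob_space_crowd_space)
  have B: "B \<ge> b" and \<theta>1: "\<And>i. i \<in> {1..n} \<Longrightarrow> \<bar>\<theta> i\<bar> \<le> 1"
    using \<theta> by (auto simp: Theta_def B_def abs_le_iff)
  have B0: "B > 0" using B b by simp
  have \<alpha>0: "0 \<le> \<alpha>" and \<alpha>2: "\<alpha>\<^sup>2 > 0" using \<alpha> by simp_all
  have v1: "v * (a ^ 4 * \<epsilon>\<^sup>2) \<ge> 400000 * L"
    using t1 \<alpha>2 a \<epsilon> by (simp add: v_def field_simps)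
  have v2: "v * (a\<^sup>2 * b\<^sup>2) \<ge> 2000000 * (n * L)"
    using t2 \<alpha>2 a b by (simp add: v_def field_simps)
  have v: "v > 0"
  proof (rule ccontr)
    assume "\<not> v > 0"
    then have "v * (a ^ 4 * \<epsilon>\<^sup>2) \<le> 0" by (intro mult_nonpos_nonneg) auto
    then show False using v1 L by linarith
  qed
  have \<eta>2: "\<eta>\<^sup>2 * v = 224 * L" using L v by (simp add: \<eta>_def)
  have \<eta>0: "\<eta> > 0" using L v by (simp add: \<eta>_def)
  \<comment> \<open>After squaring this needs \<open>4 * 224 * 400 = 358400\<close>, which the
    constant 400000 covers.\<close>
  have \<eta>\<kappa>: "2 * \<eta> \<le> a\<^sup>2 * \<epsilon> / 20"
  proof (rule power2_le_imp_le)
    have "v * (2 * \<eta>)\<^sup>2 \<le> v * (a\<^sup>2 * \<epsilon> / 20)\<^sup>2"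
      using v1 \<eta>2 L by (simp add: power_mult_distrib power_divide algebra_simps)
    then show "(2 * \<eta>)\<^sup>2 \<le> (a\<^sup>2 * \<epsilon> / 20)\<^sup>2" using v by simp
  qed (use \<epsilon> in simp)
  have "a\<^sup>2 * \<epsilon> \<le> 1 * 1" using a \<epsilon> by (intro mult_mono) (auto simp: power_le_one)
  then have \<eta>half: "\<eta> \<le> 1 / 2" using \<eta>\<kappa> by simp
  \<comment> \<open>The allowance \<open>a * B / 25\<close> for a row is split in halves: one for
    the accumulated quadratic errors, one for the linear part controlled by
    \<open>Bad3\<close>.\<close>
  have n\<eta>: "2 * (n * \<eta>\<^sup>2) \<le> a * B / 50"
  proof -
    have "v * (100 * (n * \<eta>\<^sup>2)) = 22400 * (n * L)" using \<eta>2 by (simp add: algebra_simps)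
    also have "\<dots> \<le> 2000000 * (n * L)" using L by (intro mult_right_mono) auto
    also have "\<dots> \<le> v * (a\<^sup>2 * b\<^sup>2)" by (rule v2)
    finally have "100 * (n * \<eta>\<^sup>2) \<le> a\<^sup>2 * b\<^sup>2" using v by simp
    also have "\<dots> \<le> a * B"
    proof -
      have "a\<^sup>2 \<le> a" "b\<^sup>2 \<le> b" using a b by (simp_all add: power2_eq_square mult_left_le)
      then show ?thesis using B a B0 by (intro mult_mono) auto
    qed
    finally show ?thesis by simp
  qed
  define P where "P = {(i, k). i \<in> {1..n} \<and> k \<in> {1..n} \<and> i \<noteq> k}"
  define Bad1 where "Bad1 = (\<lambda>(i, k). {\<omega> \<in> space M. \<eta> * v \<le> \<bar>pair_dev \<theta> t \<omega> i k\<bar>})"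
  define Bad2 where "Bad2 = (\<lambda>(i, k). {\<omega> \<in> space M. \<eta> * v \<le>
      \<bar>\<Sum>s=1..t. of_int \<bar>snd (\<omega> s) i * snd (\<omega> s) k\<bar> - \<alpha>\<^sup>2\<bar>})"
  define Bad3 where "Bad3 k = {\<omega> \<in> space M. a * B / 50 * v \<le> \<bar>\<Sum>i\<in>{1..n} - {k}. pair_dev \<theta> t \<omega> i k\<bar>}" for k
  have P: "finite P" "card P \<le> n\<^sup>2"
  proof -
    have sub: "P \<subseteq> {1..n} \<times> {1..n}" by (auto simp: P_def)
    then show "finite P" by (rule finite_subset) auto
    have "card P \<le> card ({1..n} \<times> {1..n})" using sub by (intro card_mono) auto
    then show "card P \<le> n\<^sup>2" by (simp add: power2_eq_square)
  qed
  have bad1: "prob (Bad1 q) \<le> 2 * exp (- (2 * L))" "Bad1 q \<in> events" if "q \<in> P" for q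
  proof -
    obtain i k where q: "q = (i, k)" by fastforce
    have ik: "i \<in> {1..n}" "k \<in> {1..n}" "i \<noteq> k" using that by (auto simp: P_def q)
    have "(\<theta> i)\<^sup>2 \<le> 1" using \<theta>1[OF ik(1)] by (simp add: abs_square_le_1)
    \<comment> \<open>A pair is a star with one leaf: \<open>K = 2\<close> turns
      \<open>56 * K\<close> into 112.\<close>
    then have K: "(\<Sum>i\<in>{i}. \<theta> i)\<^sup>2 + card {i} \<le> 2" by simp
    have y: "\<eta>\<^sup>2 \<le> 112 * 2" using \<eta>half \<eta>0 power_mono[of \<eta> 1 2] by simp
    have i: "{i} \<subseteq> {1..n} - {k}" using ik by simp
    have eq: "Bad1 q = {\<omega> \<in> space (crowd_space n \<alpha> \<theta>). \<eta> * (\<alpha>\<^sup>2 * real t) \<le> \<bar>\<Sum>s=1..t. \<Sum>i\<in>{i}.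
        of_int (snd (\<omega> s) i * snd (\<omega> s) k) - \<theta> i * \<theta> k * of_int \<bar>snd (\<omega> s) i * snd (\<omega> s) k\<bar>\<bar>}"
      unfolding Bad1_def q M_def v_def pair_dev_def by simp
    have "prob (Bad1 q) \<le> 2 * exp (- (\<eta>\<^sup>2 * \<alpha>\<^sup>2 * t / (56 * 2)))" "Bad1 q \<in> events"
      unfolding eq M_def
      by (rule star_tail[OF \<alpha>0 \<alpha>(2) \<theta>1 ik(2) i insert_not_empty K zero_less_numeral \<eta>0 y, where t = t]; assumption)+
    moreover have "\<eta>\<^sup>2 * \<alpha>\<^sup>2 * t / (56 * 2) = 2 * L"
      using \<eta>2 by (simp add: v_def mult.assoc)
    ultimately show "prob (Bad1 q) \<le> 2 * exp (- (2 * L))" "Bad1 q \<in> events" by simp_all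
  qed
  have bad2: "prob (Bad2 q) \<le> 2 * exp (- (2 * L))" "Bad2 q \<in> events" if "q \<in> P" for q
  proof -
    obtain i k where q: "q = (i, k)" by fastforce
    have ik: "i \<in> {1..n}" "k \<in> {1..n}" "i \<noteq> k" using that by (auto simp: P_def q)
    have eq: "Bad2 q = {\<omega> \<in> space (crowd_space n \<alpha> \<theta>). \<eta> * (\<alpha>\<^sup>2 * real t) \<le>
        \<bar>\<Sum>s=1..t. of_int \<bar>snd (\<omega> s) i * snd (\<omega> s) k\<bar> - \<alpha>\<^sup>2\<bar>}"
      by (simp only: Bad2_def q M_def v_def prod.case)
    have \<eta>le2: "\<eta> \<le> 2" using \<eta>half by simp
    have "prob (Bad2 q) \<le> 2 * exp (- (\<eta>\<^sup>2 * \<alpha>\<^sup>2 * t / 4))" "Bad2 q \<in> events"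
      unfolding eq M_def
      by (rule pair_count_tail[OF \<alpha>0 \<alpha>(2) \<theta>1 ik(2,1,3) \<eta>0 \<eta>le2, where t = t]; assumption)+
    moreover have "2 * L \<le> \<eta>\<^sup>2 * \<alpha>\<^sup>2 * t / 4"
      using \<eta>2 L by (simp add: v_def mult.assoc)
    ultimately show "prob (Bad2 q) \<le> 2 * exp (- (2 * L))" "Bad2 q \<in> events"
      by (auto elim: order_trans)
  qed
  have bad3: "prob (Bad3 k) \<le> 2 * exp (- (2 * L))" "Bad3 k \<in> events" if k: "k \<in> {1..n}" for k
  proof -
    let ?S = "{1..n} - {k}"
    define K where "K = (B - \<theta> k)\<^sup>2 + n"
    define y where "y = a * B / 50"
    have Ksum: "(\<Sum>i\<in>?S. \<theta> i) = B - \<theta> k"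
      using k by (simp add: B_def B_theta_def sum_diff1)
    have S: "?S \<noteq> {}"
    proof -
      have "card ?S = n - 1" using k by simp
      then show ?thesis using n by (metis card.empty diff_is_0_eq not_numeral_le_zero numeral_le_one_iff order_trans semiring_norm(70))
    qed
    have K: "(\<Sum>i\<in>?S. \<theta> i)\<^sup>2 + card ?S \<le> K" "0 < K"
      unfolding Ksum K_def using n k by (auto intro!: add_nonneg_pos)
    have \<theta>k: "(\<theta> k)\<^sup>2 \<le> 1" using \<theta>1[OF k] by (simp add: abs_square_le_1)
    have n3: "real n \<ge> 3" using n by simp
    \<comment> \<open>The two squares compare \<open>B\<^sup>2\<close> with
      \<open>(B - \<theta> k)\<^sup>2\<close> in both directions up to a factor 2; the leftover
      \<open>2 * (\<theta> k)\<^sup>2\<close> is absorbed by \<open>n\<close>.\<close>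
    have "0 \<le> (B - 2 * \<theta> k)\<^sup>2" by simp
    then have B2: "B\<^sup>2 \<le> 2 * K"
      using \<theta>k n3 by (simp add: K_def power2_eq_square algebra_simps)
    have "0 \<le> (B + \<theta> k)\<^sup>2" by simp
    then have K_le: "K \<le> 2 * B\<^sup>2 + 2 * n"
      using \<theta>k n3 by (simp add: K_def power2_eq_square algebra_simps)
    have y2: "y\<^sup>2 \<le> 112 * K"
    proof -
      have "a\<^sup>2 * B\<^sup>2 \<le> 1 * B\<^sup>2" using a by (intro mult_right_mono) (auto simp: power_le_one)
      then show ?thesis using B2 K by (simp add: y_def power_mult_distrib power_divide)
    qed
    have "prob (Bad3 k) \<le> 2 * exp (- (y\<^sup>2 * \<alpha>\<^sup>2 * t / (56 * K)))" "Bad3 k \<in> events"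
    proof -
      have "(\<Sum>i\<in>?S. pair_dev \<theta> t \<omega> i k) = (\<Sum>s=1..t. \<Sum>i\<in>?S. of_int (snd (\<omega> s) i * snd (\<omega> s) k) -
          \<theta> i * \<theta> k * of_int \<bar>snd (\<omega> s) i * snd (\<omega> s) k\<bar>)" for \<omega>
        unfolding pair_dev_def by (rule sum.swap)
      then have eq: "Bad3 k = {\<omega> \<in> space (crowd_space n \<alpha> \<theta>). y * (\<alpha>\<^sup>2 * real t) \<le>
          \<bar>\<Sum>s=1..t. \<Sum>i\<in>?S. of_int (snd (\<omega> s) i * snd (\<omega> s) k) - \<theta> i * \<theta> k * of_int \<bar>snd (\<omega> s) i * snd (\<omega> s) k\<bar>\<bar>}"
        by (simp only: Bad3_def M_def y_def v_def)
      have y0: "0 < y" using a B0 by (simp add: y_def)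
      show "prob (Bad3 k) \<le> 2 * exp (- (y\<^sup>2 * \<alpha>\<^sup>2 * t / (56 * K)))" "Bad3 k \<in> events"
        unfolding eq M_def
        by (rule star_tail[OF \<alpha>0 \<alpha>(2) \<theta>1 k subset_refl S K y0 y2, where t = t]; assumption)+
    qed
    moreover have "2 * L \<le> y\<^sup>2 * \<alpha>\<^sup>2 * t / (56 * K)"
    proof -
      \<comment> \<open>\<open>K\<close> contains \<open>B\<^sup>2\<close> and \<open>n\<close>,
        while \<open>y\<^sup>2\<close> scales like \<open>B\<^sup>2\<close>. Multiplying by
        \<open>b\<^sup>2\<close> bounds both parts by multiples of \<open>n * B\<^sup>2\<close>, so
        one factor \<open>n\<close> in the condition on \<open>t\<close> suffices for every size of
        \<open>B\<close>. The exponent needs \<open>112 * 2500 = 280000\<close>; the condition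
        provides \<open>2000000 / 4 = 500000\<close>.\<close>
      have "b\<^sup>2 \<le> 1" using b by (simp add: power_le_one)
      have bB: "b\<^sup>2 \<le> B\<^sup>2" using B b by (intro power_mono) auto
      have "b\<^sup>2 * K \<le> b\<^sup>2 * (2 * B\<^sup>2 + 2 * n)" using K_le by (intro mult_left_mono) auto
      also have "\<dots> = 2 * (b\<^sup>2 * B\<^sup>2) + 2 * n * b\<^sup>2" by (simp add: algebra_simps)
      also have "\<dots> \<le> 2 * (n * B\<^sup>2) + 2 * n * B\<^sup>2"
        using \<open>b\<^sup>2 \<le> 1\<close> bB n3 by (intro add_mono mult_left_mono mult_right_mono) auto
      finally have bK: "b\<^sup>2 * K \<le> 4 * n * B\<^sup>2" by simp
      have "2000000 * (n * L) * K \<le> v * (a\<^sup>2 * b\<^sup>2) * K" using v2 K by (intro mult_right_mono) auto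
      also have "\<dots> = v * a\<^sup>2 * (b\<^sup>2 * K)" by simp
      also have "\<dots> \<le> v * a\<^sup>2 * (4 * n * B\<^sup>2)" using bK v by (intro mult_left_mono) auto
      finally have "n * (2000000 * L * K) \<le> n * (4 * v * a\<^sup>2 * B\<^sup>2)" by (simp add: algebra_simps)
      then have "2000000 * L * K \<le> 4 * v * a\<^sup>2 * B\<^sup>2" using n3 by simp
      then have "500000 * (L * K) \<le> v * (a\<^sup>2 * B\<^sup>2)" by (simp add: algebra_simps)
      moreover have "2 * L * (56 * K) = 112 * (L * K)" by simp
      ultimately have "2 * L * (56 * K) \<le> v * (a\<^sup>2 * B\<^sup>2) / 2500"
        using mult_pos_pos[OF L K(2)] by linarith
      also have "\<dots> = y\<^sup>2 * \<alpha>\<^sup>2 * t" by (simp add: y_def v_def power_divide power_mult_distrib)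
      finally show ?thesis using K by (simp add: le_divide_eq)
    qed
    ultimately show "prob (Bad3 k) \<le> 2 * exp (- (2 * L))" "Bad3 k \<in> events"
      by (auto elim: order_trans)
  qed
  let ?U1 = "\<Union>q\<in>P. Bad1 q" and ?U2 = "\<Union>q\<in>P. Bad2 q" and ?U3 = "\<Union>k\<in>{1..n}. Bad3 k"
  have ev: "?U1 \<in> events" "?U2 \<in> events" "?U3 \<in> events"
    using P bad1 bad2 bad3 by auto
  have "{\<omega> \<in> space M. linf_dist n (TE (observations n t \<omega>)) \<theta> \<ge> \<epsilon>} \<subseteq> ?U1 \<union> ?U2 \<union> ?U3"
  proof (intro subsetI; rule ccontr)
    fix \<omega> assume \<omega>: "\<omega> \<in> {\<omega> \<in> space M. linf_dist n (TE (observations n t \<omega>)) \<theta> \<ge> \<epsilon>}"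
      and not_bad: "\<omega> \<notin> ?U1 \<union> ?U2 \<union> ?U3"
    have \<omega>M: "\<omega> \<in> space M" using \<omega> by simp
    have good1: "\<bar>pair_dev \<theta> t \<omega> i k\<bar> \<le> \<eta> * v" if "(i, k) \<in> P" for i k
    proof -
      have "\<omega> \<notin> Bad1 (i, k)" using not_bad that by blast
      then show ?thesis
        using \<omega>M unfolding Bad1_def prod.case mem_Collect_eq not_le de_Morgan_conj by (blast intro: less_imp_le)
    qed
    have good2: "\<bar>\<Sum>s=1..t. of_int \<bar>snd (\<omega> s) i * snd (\<omega> s) k\<bar> - \<alpha>\<^sup>2\<bar> \<le> \<eta> * v" if "(i, k) \<in> P" for i k
    proof -
      have "\<omega> \<notin> Bad2 (i, k)" using not_bad that by blast
      then show ?thesis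
        using \<omega>M unfolding Bad2_def prod.case mem_Collect_eq not_le de_Morgan_conj by (blast intro: less_imp_le)
    qed
    have good3: "\<bar>\<Sum>i\<in>{1..n} - {k}. pair_dev \<theta> t \<omega> i k\<bar> \<le> a * B / 50 * v" if "k \<in> {1..n}" for k
    proof -
      have "\<omega> \<notin> Bad3 k" using not_bad that by blast
      then show ?thesis
        using \<omega>M unfolding Bad3_def mem_Collect_eq not_le de_Morgan_conj by (blast intro: less_imp_le)
    qed
    let ?C = "C_hat t (observations n t \<omega>)"
    have C: "\<bar>?C i k - \<theta> i * \<theta> k\<bar> \<le> 2 * \<eta>"
      and C': "\<bar>?C i k - \<theta> i * \<theta> k - pair_dev \<theta> t \<omega> i k / v\<bar> \<le> 2 * \<eta>\<^sup>2"
      if ik: "i \<in> {1..n}" "k \<in> {1..n}" "i \<noteq> k" for i k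
    proof -
      have mem: "(i, k) \<in> P" using ik by (simp add: P_def)
      show "\<bar>?C i k - \<theta> i * \<theta> k\<bar> \<le> 2 * \<eta>"
        "\<bar>?C i k - \<theta> i * \<theta> k - pair_dev \<theta> t \<omega> i k / v\<bar> \<le> 2 * \<eta>\<^sup>2"
        by (rule C_hat_observations_dev[OF v_def v \<eta>half ik(1,2) good1[OF mem] good2[OF mem]])+
    qed
    have row: "\<bar>\<Sum>i\<in>{1..n} - {k}. ?C i k - \<theta> i * \<theta> k\<bar> \<le> a * B_theta n \<theta> / 25" if k: "k \<in> {1..n}" for k
    proof -
      let ?S = "{1..n} - {k}"
      have "\<bar>\<Sum>i\<in>?S. ?C i k - \<theta> i * \<theta> k - pair_dev \<theta> t \<omega> i k / v\<bar> \<le> (\<Sum>i\<in>?S. 2 * \<eta>\<^sup>2)"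
        by (intro order_trans[OF sum_abs] sum_mono C'; use k in blast)
      also have "\<dots> \<le> 2 * (n * \<eta>\<^sup>2)"
        using k by (simp add: mult_right_mono)
      finally have "\<bar>(\<Sum>i\<in>?S. ?C i k - \<theta> i * \<theta> k) - (\<Sum>i\<in>?S. pair_dev \<theta> t \<omega> i k) / v\<bar> \<le> a * B / 50"
        using n\<eta> unfolding sum_subtractf sum_divide_distrib by linarith
      moreover have "\<bar>(\<Sum>i\<in>?S. pair_dev \<theta> t \<omega> i k) / v\<bar> \<le> a * B / 50"
        using good3[OF k] unfolding abs_divide abs_of_pos[OF v] pos_divide_le_eq[OF v] .
      ultimately show ?thesis unfolding B_def by linarith
    qed
    have "\<bar>TE (observations n t \<omega>) k - \<theta> k\<bar> < \<epsilon>" if "k \<in> {1..n}" for k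
      by (rule TE_error_lt[OF n a b(1) \<theta> \<epsilon> TE C \<eta>\<kappa> row that])
    then have "linf_dist n (TE (observations n t \<omega>)) \<theta> < \<epsilon>"
      using n by (auto simp: linf_dist_def)
    then show False using \<omega> by simp
  qed
  then have "prob {\<omega> \<in> space M. linf_dist n (TE (observations n t \<omega>)) \<theta> \<ge> \<epsilon>} \<le> prob (?U1 \<union> ?U2 \<union> ?U3)"
    using ev by (intro finite_measure_mono) auto
  also have "\<dots> \<le> prob (?U1 \<union> ?U2) + prob ?U3"
    using ev by (intro measure_Un_le) auto
  also have "\<dots> \<le> prob ?U1 + prob ?U2 + prob ?U3"
    using ev by (intro add_mono measure_Un_le) auto
  also have "\<dots> \<le> (\<Sum>q\<in>P. prob (Bad1 q)) + (\<Sum>q\<in>P. prob (Bad2 q)) + (\<Sum>k\<in>{1..n}. prob (Bad3 k))"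
    using P bad1 bad2 bad3 by (intro add_mono measure_UNION_le) auto
  also have "\<dots> \<le> (\<Sum>q\<in>P. 2 * exp (- (2 * L))) + (\<Sum>q\<in>P. 2 * exp (- (2 * L))) + (\<Sum>k\<in>{1..n}. 2 * exp (- (2 * L)))"
    using bad1 bad2 bad3 by (intro add_mono sum_mono) auto
  \<comment> \<open>Two events per ordered pair and one per row, each of probability at most
    \<open>2 * exp (- (2 * L))\<close>.\<close>
  also have "\<dots> = (4 * real (card P) + 2 * n) * exp (- (2 * L))"
    by (simp add: algebra_simps)
  also have "\<dots> \<le> (6 * (real n)\<^sup>2) * exp (- (2 * L))"
  proof (rule mult_right_mono)
    have "real (card P) \<le> (real n)\<^sup>2" using P(2) by (metis of_nat_le_iff of_nat_power)
    moreover have "real n * 1 \<le> real n * real n" using n by (intro mult_left_mono) auto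
    ultimately show "4 * real (card P) + 2 * n \<le> 6 * (real n)\<^sup>2" by (simp add: power2_eq_square)
  qed simp
  finally show ?thesis unfolding M_def .
qed

theorem theorem2:
  "\<exists>c1 > 0. \<exists>c2 > 0.
     \<forall>(n :: nat) (\<alpha> :: real) (a :: real) (b :: real) (\<theta> :: nat \<Rightarrow> real) (\<epsilon> :: real) (\<delta> :: real) (t :: nat)
       (TE :: (nat \<Rightarrow> nat \<Rightarrow> int) \<Rightarrow> nat \<Rightarrow> real).
       n \<ge> 3 \<longrightarrow> \<alpha> \<in> {0<..1} \<longrightarrow> a \<in> {0<..<1} \<longrightarrow> b \<in> {0<..<1} \<longrightarrow> \<theta> \<in> Theta n a b \<longrightarrow>
       \<epsilon> \<in> {0<..<min (b / 3) 1} \<longrightarrow> \<delta> \<in> {0<..<1} \<longrightarrow>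
       (\<forall>x. is_TE n t x (TE x)) \<longrightarrow>
       real t \<ge> max (c1 * (1 / (\<alpha>\<^sup>2 * a ^ 4 * \<epsilon>\<^sup>2)) * ln (6 * (real n)\<^sup>2 / \<delta>))
                    (c2 * (real n / (\<alpha>\<^sup>2 * a\<^sup>2 * b\<^sup>2)) * ln (4 * (real n)\<^sup>2 / \<delta>)) \<longrightarrow>
       measure (crowd_space n \<alpha> \<theta>)
         {\<omega> \<in> space (crowd_space n \<alpha> \<theta>). linf_dist n (TE (observations n t \<omega>)) \<theta> \<ge> \<epsilon>} \<le> \<delta>"
proof (rule exI[of _ 400000], intro conjI; (rule exI[of _ 2000000], intro conjI allI impI)?)
  fix n :: nat and \<alpha> a b :: real and \<theta> :: "nat \<Rightarrow> real" and \<epsilon> \<delta> :: real and t :: nat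
    and TE :: "(nat \<Rightarrow> nat \<Rightarrow> int) \<Rightarrow> nat \<Rightarrow> real"
  assume n: "n \<ge> 3" and \<alpha>: "\<alpha> \<in> {0<..1}" and a: "a \<in> {0<..<1}" and b: "b \<in> {0<..<1}"
    and \<theta>: "\<theta> \<in> Theta n a b" and \<epsilon>: "\<epsilon> \<in> {0<..<min (b / 3) 1}" and \<delta>: "\<delta> \<in> {0<..<1}"
    and TE: "\<forall>x. is_TE n t x (TE x)"
    and t: "max (400000 * (1 / (\<alpha>\<^sup>2 * a ^ 4 * \<epsilon>\<^sup>2)) * ln (6 * (real n)\<^sup>2 / \<delta>))
        (2000000 * (real n / (\<alpha>\<^sup>2 * a\<^sup>2 * b\<^sup>2)) * ln (4 * (real n)\<^sup>2 / \<delta>)) \<le> real t"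
  \<comment> \<open>The smaller of the two logarithms is used throughout, so that both conditions on
    \<open>t\<close> apply to the same \<open>L\<close>.\<close>
  define L where "L = ln (4 * (real n)\<^sup>2 / \<delta>)"
  have n2: "(real n)\<^sup>2 \<ge> 9" using n power_mono[of 3 "real n" 2] by simp
  then have ratio: "4 * (real n)\<^sup>2 / \<delta> > 1" using \<delta> by (simp add: field_simps)
  then have L: "0 < L" by (simp add: L_def)
  have L6: "L \<le> ln (6 * (real n)\<^sup>2 / \<delta>)"
    unfolding L_def using order.strict_trans[OF zero_less_one ratio] \<delta>
    by (intro ln_mono divide_right_mono mult_right_mono) auto
  have t1: "real t \<ge> 400000 * L / (\<alpha>\<^sup>2 * a ^ 4 * \<epsilon>\<^sup>2)"
  proof -
    have "400000 * L / (\<alpha>\<^sup>2 * a ^ 4 * \<epsilon>\<^sup>2) = 400000 * (1 / (\<alpha>\<^sup>2 * a ^ 4 * \<epsilon>\<^sup>2)) * L" by simp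
    also have "\<dots> \<le> 400000 * (1 / (\<alpha>\<^sup>2 * a ^ 4 * \<epsilon>\<^sup>2)) * ln (6 * (real n)\<^sup>2 / \<delta>)"
      by (intro mult_left_mono L6) simp
    finally show ?thesis using t by linarith
  qed
  have t2: "real t \<ge> 2000000 * n * L / (\<alpha>\<^sup>2 * a\<^sup>2 * b\<^sup>2)"
    using t by (simp add: L_def mult.assoc)
  have "measure (crowd_space n \<alpha> \<theta>)
      {\<omega> \<in> space (crowd_space n \<alpha> \<theta>). linf_dist n (TE (observations n t \<omega>)) \<theta> \<ge> \<epsilon>}
    \<le> 6 * (real n)\<^sup>2 * exp (- (2 * L))"
    using n \<alpha> a b \<theta> \<epsilon> TE L t1 t2 by (intro TE_failure_le) auto
  also have "exp (- (2 * L)) = (\<delta> / (4 * (real n)\<^sup>2))\<^sup>2"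
  proof -
    have "exp (- (2 * L)) = (inverse (exp L))\<^sup>2"
      by (simp add: power2_eq_square flip: exp_add exp_minus)
    also have "exp L = 4 * (real n)\<^sup>2 / \<delta>" unfolding L_def using ratio by simp
    finally show ?thesis by simp
  qed
  \<comment> \<open>The exponent \<open>2 * L\<close> squares
    \<open>\<delta> / (4 * (real n)\<^sup>2)\<close>; one factor cancels the number of events and
    the remaining one leaves ample slack.\<close>
  also have "6 * (real n)\<^sup>2 * (\<delta> / (4 * (real n)\<^sup>2))\<^sup>2 = \<delta> * (3 * \<delta> / (8 * (real n)\<^sup>2))"
    using n by (simp add: field_simps power2_eq_square)
  also have "\<dots> \<le> \<delta> * 1"
    using \<delta> n2 by (intro mult_left_mono) (auto simp: divide_le_eq)
  finally show "measure (crowd_space n \<alpha> \<theta>)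
      {\<omega> \<in> space (crowd_space n \<alpha> \<theta>). linf_dist n (TE (observations n t \<omega>)) \<theta> \<ge> \<epsilon>} \<le> \<delta>"
    by simp
qed auto

end
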